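(* Let $(X,\omega)$ be a symplectic manifold (compact or not) and let $\star$ be a star product making $(C^\infty(X)[[\hbar]],\star)$ a formal deformation quantization of $X$. Then $C^\infty(X)[[\hbar]]$ equipped with the product $\star$ and with the family of semi-norms $\{\|\cdot\|_{\hbar,k}\}_{k\ge 0}$ is a Fréchet algebra.
   Context: Functions are real- or complex-valued (one choice of scalars $\mathbb{K}\in\{\mathbb{R},\mathbb{C}\}$ is fixed); $\hbar$ is a formal variable. Formal deformation quantization: an associative, $\mathbb{K}[[\hbar]]$-bilinear product $\star$ on $C^\infty(X)[[\hbar]]$ such that for $f,g\in C^\infty(X)$ one has $f\star g=fg+\sum_{i\ge 1}\hbar^i C_i(f,g)$, where each $C_i$ is a bi-differential operator of order at most $i$ in each argument, and $C_1(f,g)-C_1(g,f)=\{f,g\}$, the Poisson bracket associated to $\omega$. Semi-norms on $C^\infty(X)$: fix a countable (possibly finite) covering $X=\bigcup_{i\ge 0}U_i$ by open sets such that each finite union of the $U_i$ has compact closure, with a fixed coordinate system on each $U_i$ (defined on a neighbourhood of the closure $\overline{U_i}$). For $l\ge 0$ and $f\in C^\infty(X)$, $$\|f\|_l:=\sup\Big\{\Big|\frac{\partial^{|I|}f}{\partial x^I}(x_0)\Big| : x_0\in\bigcup_{i\le l}\overline{U_i},\ |I|\le l\Big\},$$ where $I$ is a multi-index, and at a point $x_0\in\overline{U_i}$ ($i\le l$) the partial derivatives are taken in the chosen coordinates of $U_i$ (the supremum is over all such $i$). Semi-norms on $C^\infty(X)[[\hbar]]$: for $f=f_0+\hbar f_1+\hbar^2f_2+\cdots$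 with $f_i\in C^\infty(X)$ and $k\ge 0$, $\|f\|_{\hbar,k}:=\sum_{i+j=k}\|f_i\|_j$. Fréchet space: a vector space $V$ with a countable family of semi-norms $\{\|\cdot\|_k\}_{k\ge 0}$ such that (i) $\|x\|_k=0$ for all $k$ implies $x=0$, and (ii) every sequence that is Cauchy with respect to each $\|\cdot\|_k$ converges, with respect to each $\|\cdot\|_k$, to some common $x\in V$. Its topology is that of the metric $d(x,y)=\sum_{k\ge 0}2^{-k}\frac{\|x-y\|_k}{1+\|x-y\|_k}$. Fréchet algebra: an associative algebra over $\mathbb{R}$ or $\mathbb{C}$ which is also a Fréchet space and whose multiplication is jointly continuous, i.e. $a_k\to a$ and $b_k\to b$ imply $a_k\star b_k\to a\star b$. *)

theory Defs
  imports
    "HOL-Analysis.Analysis"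
    "HOL-Computational_Algebra.Formal_Power_Series"
    "HOL-Library.Function_Algebras"
begin

section \<open>Partial derivatives and smoothness on open subsets of Euclidean n-space\<close>

text \<open>
  Euclidean n-space is the library topology \<^const>\<open>Euclidean_space\<close>: its points are the maps
  from \<^typ>\<open>nat\<close> to \<^typ>\<open>real\<close> that vanish from index n on.  The dimension n is a natural number,
  so n = 0 is allowed.

  The scalars are a type of sort \<open>real_normed_field\<close>.  Up to isometric isomorphism the only complete
  ones are the real and the complex numbers (Gelfand-Mazur), so \<open>'k::{real_normed_field,banach}\<close>
  stands for a choice between these two.
\<close>

definition partial :: "nat \<Rightarrow> ((nat \<Rightarrow> real) \<Rightarrow> 'k::real_normed_vector) \<Rightarrow> (nat \<Rightarrow> real) \<Rightarrow> 'k" where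
  "partial i g y = vector_derivative (\<lambda>t. g (y(i := t))) (at (y i))"

text \<open>\<open>S\<close> is meant to be open in \<open>Euclidean_space n\<close>; the values of \<open>g\<close> off \<open>S\<close> are then irrelevant.\<close>

definition smooth_on :: "nat \<Rightarrow> (nat \<Rightarrow> real) set \<Rightarrow> ((nat \<Rightarrow> real) \<Rightarrow> 'k::real_normed_vector) \<Rightarrow> bool" where
  "smooth_on n S g \<longleftrightarrow>
     (\<forall>is. set is \<subseteq> {..<n} \<longrightarrow>
        continuous_on S (foldr partial is g) \<and>
        (\<forall>i<n. \<forall>y\<in>S. (\<lambda>t. foldr partial is g (y(i := t))) differentiable (at (y i))))"

definition multi_indices :: "nat \<Rightarrow> nat \<Rightarrow> (nat \<Rightarrow> nat) set" where
  "multi_indices n m = {I. (\<forall>i\<ge>n. I i = 0) \<and> (\<Sum>i<n. I i) \<le> m}"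

definition multi_partial ::
  "nat \<Rightarrow> (nat \<Rightarrow> nat) \<Rightarrow> ((nat \<Rightarrow> real) \<Rightarrow> 'k::real_normed_vector) \<Rightarrow> (nat \<Rightarrow> real) \<Rightarrow> 'k" where
  "multi_partial n I = foldr (\<lambda>i. partial i ^^ I i) [0..<n]"

section \<open>Smooth manifolds\<close>

text \<open>
  A chart is a domain together with a coordinate map, whose values off the domain are irrelevant.
  The empty domain is allowed.
\<close>

type_synonym 'x chart = "'x set \<times> ('x \<Rightarrow> nat \<Rightarrow> real)"

definition is_chart :: "nat \<Rightarrow> 'x::topological_space chart \<Rightarrow> bool" where
  "is_chart n c \<longleftrightarrow>
     open (fst c) \<and> openin (Euclidean_space n) (snd c ` fst c) \<and>
     homeomorphism (fst c) (snd c ` fst c) (snd c) (inv_into (fst c) (snd c))"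

definition in_coords :: "'x chart \<Rightarrow> ('x \<Rightarrow> 'k) \<Rightarrow> (nat \<Rightarrow> real) \<Rightarrow> 'k" where
  "in_coords c f = f \<circ> inv_into (fst c) (snd c)"

definition smooth_transition :: "nat \<Rightarrow> 'x chart \<Rightarrow> 'x chart \<Rightarrow> bool" where
  "smooth_transition n c c' \<longleftrightarrow>
     (\<forall>i<n. smooth_on n (snd c ` (fst c \<inter> fst c')) (in_coords c (\<lambda>p. snd c' p i)))"

definition compatible_charts :: "nat \<Rightarrow> 'x chart \<Rightarrow> 'x chart \<Rightarrow> bool" where
  "compatible_charts n c c' \<longleftrightarrow> smooth_transition n c c' \<and> smooth_transition n c' c"

text \<open>The charts of a smooth manifold are those of a maximal atlas.\<close>

definition smooth_manifold ::
  "nat \<Rightarrow> 'x::{t2_space,second_countable_topology} chart set \<Rightarrow> bool" where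
  "smooth_manifold n A \<longleftrightarrow>
     (\<forall>c\<in>A. is_chart n c) \<and>
     (\<Union>c\<in>A. fst c) = UNIV \<and>
     (\<forall>c\<in>A. \<forall>c'\<in>A. compatible_charts n c c') \<and>
     (\<forall>c. is_chart n c \<and> (\<forall>c'\<in>A. compatible_charts n c c') \<longrightarrow> c \<in> A)"

definition smooth_in_chart :: "nat \<Rightarrow> 'x chart \<Rightarrow> ('x \<Rightarrow> 'k::real_normed_vector) \<Rightarrow> bool" where
  "smooth_in_chart n c f \<longleftrightarrow> smooth_on n (snd c ` fst c) (in_coords c f)"

definition smooth_functions :: "nat \<Rightarrow> 'x chart set \<Rightarrow> ('x \<Rightarrow> 'k::real_normed_vector) set" where
  "smooth_functions n A = {f. \<forall>c\<in>A. smooth_in_chart n c f}"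

definition coord_partial :: "'x chart \<Rightarrow> nat \<Rightarrow> ('x \<Rightarrow> 'k::real_normed_vector) \<Rightarrow> 'x \<Rightarrow> 'k" where
  "coord_partial c i f p = partial i (in_coords c f) (snd c p)"

definition coord_multi_partial ::
  "nat \<Rightarrow> 'x chart \<Rightarrow> (nat \<Rightarrow> nat) \<Rightarrow> ('x \<Rightarrow> 'k::real_normed_vector) \<Rightarrow> 'x \<Rightarrow> 'k" where
  "coord_multi_partial n c I f p = multi_partial n I (in_coords c f) (snd c p)"

section \<open>Symplectic forms and the Poisson bracket\<close>

text \<open>
  A two-form is given by its components \<open>\<omega> c i j p\<close> with respect to each chart \<open>c\<close>, subject to the
  tensorial transformation law.  Only indices below \<open>n\<close> and points of the domain of \<open>c\<close> matter.
\<close>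

type_synonym 'x two_form = "'x chart \<Rightarrow> nat \<Rightarrow> nat \<Rightarrow> 'x \<Rightarrow> real"

definition is_two_form :: "nat \<Rightarrow> 'x chart set \<Rightarrow> 'x two_form \<Rightarrow> bool" where
  "is_two_form n A \<omega> \<longleftrightarrow>
     (\<forall>c\<in>A. \<forall>i<n. \<forall>j<n. smooth_in_chart n c (\<omega> c i j)) \<and>
     (\<forall>c\<in>A. \<forall>i<n. \<forall>j<n. \<forall>p\<in>fst c. \<omega> c i j p = - \<omega> c j i p) \<and>
     (\<forall>c\<in>A. \<forall>c'\<in>A. \<forall>p\<in>fst c \<inter> fst c'. \<forall>k<n. \<forall>l<n.
        \<omega> c' k l p =
          (\<Sum>i<n. \<Sum>j<n. \<omega> c i j p * coord_partial c' k (\<lambda>q. snd c q i) p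
                                    * coord_partial c' l (\<lambda>q. snd c q j) p))"

definition closed_two_form :: "nat \<Rightarrow> 'x chart set \<Rightarrow> 'x two_form \<Rightarrow> bool" where
  "closed_two_form n A \<omega> \<longleftrightarrow>
     (\<forall>c\<in>A. \<forall>p\<in>fst c. \<forall>i<n. \<forall>j<n. \<forall>k<n.
        coord_partial c i (\<omega> c j k) p + coord_partial c j (\<omega> c k i) p
          + coord_partial c k (\<omega> c i j) p = 0)"

definition nondegenerate_two_form :: "nat \<Rightarrow> 'x chart set \<Rightarrow> 'x two_form \<Rightarrow> bool" where
  "nondegenerate_two_form n A \<omega> \<longleftrightarrow>
     (\<forall>c\<in>A. \<forall>p\<in>fst c. \<forall>v :: nat \<Rightarrow> real.
        (\<forall>j<n. (\<Sum>i<n. v i * \<omega> c i j p) = 0) \<longrightarrow> (\<forall>i<n. v i = 0))"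

definition symplectic_manifold ::
  "nat \<Rightarrow> 'x::{t2_space,second_countable_topology} chart set \<Rightarrow> 'x two_form \<Rightarrow> bool" where
  "symplectic_manifold n A \<omega> \<longleftrightarrow>
     smooth_manifold n A \<and> is_two_form n A \<omega> \<and> closed_two_form n A \<omega> \<and> nondegenerate_two_form n A \<omega>"

text \<open>
  Sign convention: the Hamiltonian vector field \<open>X\<^sub>f\<close> satisfies \<open>\<omega>(X\<^sub>f, \<cdot>) = df\<close>, and
  \<open>{f, g} = \<omega>(X\<^sub>f, X\<^sub>g)\<close>.  The opposite convention amounts to replacing \<open>\<omega>\<close> by \<open>-\<omega>\<close>.
  For complex-valued functions \<open>X\<^sub>f\<close> has complex coefficients.
\<close>

definition hamiltonian_field ::
  "nat \<Rightarrow> 'x two_form \<Rightarrow> 'x chart \<Rightarrow> ('x \<Rightarrow> 'k::real_normed_field) \<Rightarrow> 'x \<Rightarrow> nat \<Rightarrow> 'k" where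
  "hamiltonian_field n \<omega> c f p =
     (THE v. (\<forall>i\<ge>n. v i = 0) \<and>
             (\<forall>j<n. (\<Sum>i<n. v i * of_real (\<omega> c i j p)) = coord_partial c j f p))"

text \<open>By the transformation law the value does not depend on the chart chosen around the point.\<close>

definition poisson_bracket ::
  "nat \<Rightarrow> 'x chart set \<Rightarrow> 'x two_form \<Rightarrow>
    ('x \<Rightarrow> 'k::real_normed_field) \<Rightarrow> ('x \<Rightarrow> 'k) \<Rightarrow> 'x \<Rightarrow> 'k" where
  "poisson_bracket n A \<omega> f g p =
     (let c = (SOME c. c \<in> A \<and> p \<in> fst c) in
        \<Sum>i<n. \<Sum>j<n. of_real (\<omega> c i j p) * hamiltonian_field n \<omega> c f p i
                                        * hamiltonian_field n \<omega> c g p j)"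

section \<open>Formal deformation quantization\<close>

definition bidifferential_operator ::
  "nat \<Rightarrow> 'x chart set \<Rightarrow> nat \<Rightarrow>
    (('x \<Rightarrow> 'k::real_normed_field) \<Rightarrow> ('x \<Rightarrow> 'k) \<Rightarrow> 'x \<Rightarrow> 'k) \<Rightarrow> bool" where
  "bidifferential_operator n A m B \<longleftrightarrow>
     (\<forall>c\<in>A. \<exists>a.
        (\<forall>I\<in>multi_indices n m. \<forall>J\<in>multi_indices n m. smooth_in_chart n c (a I J)) \<and>
        (\<forall>f\<in>smooth_functions n A. \<forall>g\<in>smooth_functions n A. \<forall>p\<in>fst c.
           B f g p = (\<Sum>I\<in>multi_indices n m. \<Sum>J\<in>multi_indices n m.
                        a I J p * coord_multi_partial n c I f p * coord_multi_partial n c J g p)))"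

text \<open>
  A formal series in \<open>\<hbar>\<close> with function coefficients is an \<open>fps\<close> over the pointwise ring structure
  of \<^theory>\<open>HOL-Library.Function_Algebras\<close>; the formal variable of \<open>fps\<close> plays the role of \<open>\<hbar>\<close>.
\<close>

definition formal_functions ::
  "nat \<Rightarrow> 'x chart set \<Rightarrow> ('x \<Rightarrow> 'k::real_normed_field) fps set" where
  "formal_functions n A = {F. \<forall>i. fps_nth F i \<in> smooth_functions n A}"

definition formal_scale :: "'k::real_normed_field fps \<Rightarrow> ('x \<Rightarrow> 'k) fps \<Rightarrow> ('x \<Rightarrow> 'k) fps" where
  "formal_scale a F = Abs_fps (\<lambda>i p. fps_nth a i) * F"

definition formal_deformation_quantization ::
  "nat \<Rightarrow> 'x::{t2_space,second_countable_topology} chart set \<Rightarrow> 'x two_form \<Rightarrow>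
    (('x \<Rightarrow> 'k::real_normed_field) fps \<Rightarrow> ('x \<Rightarrow> 'k) fps \<Rightarrow> ('x \<Rightarrow> 'k) fps) \<Rightarrow> bool" where
  "formal_deformation_quantization n A \<omega> star \<longleftrightarrow>
     (let V = formal_functions n A; C\<^sub>X = smooth_functions n A in
      (\<forall>F\<in>V. \<forall>G\<in>V. star F G \<in> V) \<and>
      (\<forall>F\<in>V. \<forall>G\<in>V. \<forall>H\<in>V. star (star F G) H = star F (star G H)) \<and>
      (\<forall>F\<in>V. \<forall>G\<in>V. \<forall>H\<in>V. star (F + G) H = star F H + star G H \<and>
                                  star H (F + G) = star H F + star H G) \<and>
      (\<forall>a. \<forall>F\<in>V. \<forall>G\<in>V. star (formal_scale a F) G = formal_scale a (star F G) \<and>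
                           star F (formal_scale a G) = formal_scale a (star F G)) \<and>
      (\<exists>C. (\<forall>i\<ge>1. bidifferential_operator n A i (C i)) \<and>
           (\<forall>f\<in>C\<^sub>X. \<forall>g\<in>C\<^sub>X. star (fps_const f) (fps_const g) =
                                  Abs_fps (\<lambda>i. if i = 0 then f * g else C i f g)) \<and>
           (\<forall>f\<in>C\<^sub>X. \<forall>g\<in>C\<^sub>X. C 1 f g - C 1 g f = poisson_bracket n A \<omega> f g)))"

section \<open>The semi-norms\<close>

text \<open>
  \<open>U i\<close> is the i-th member of the covering and \<open>x i\<close> the chosen chart, defined on a neighbourhood of
  its closure.  A finite covering is one with \<open>U i = {}\<close> for all large \<open>i\<close>.
\<close>

definition coordinate_covering ::
  "'x::topological_space chart set \<Rightarrow> (nat \<Rightarrow> 'x set) \<Rightarrow> (nat \<Rightarrow> 'x chart) \<Rightarrow> bool" where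
  "coordinate_covering A U x \<longleftrightarrow>
     (\<forall>i. open (U i)) \<and> (\<Union>i. U i) = UNIV \<and>
     (\<forall>J. finite J \<longrightarrow> compact (closure (\<Union>i\<in>J. U i))) \<and>
     (\<forall>i. x i \<in> A \<and> closure (U i) \<subseteq> fst (x i))"

text \<open>Inserting 0 only matters if \<open>U i\<close> is empty for all \<open>i \<le> l\<close>.\<close>

definition smooth_seminorm ::
  "nat \<Rightarrow> (nat \<Rightarrow> 'x::topological_space set) \<Rightarrow> (nat \<Rightarrow> 'x chart) \<Rightarrow> nat \<Rightarrow>
    ('x \<Rightarrow> 'k::real_normed_field) \<Rightarrow> real" where
  "smooth_seminorm n U x l f =
     Sup (insert 0 {norm (coord_multi_partial n (x i) I f p) | i I p.
                      i \<le> l \<and> p \<in> closure (U i) \<and> I \<in> multi_indices n l})"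

definition formal_seminorm ::
  "nat \<Rightarrow> (nat \<Rightarrow> 'x::topological_space set) \<Rightarrow> (nat \<Rightarrow> 'x chart) \<Rightarrow> nat \<Rightarrow>
    ('x \<Rightarrow> 'k::real_normed_field) fps \<Rightarrow> real" where
  "formal_seminorm n U x k F = (\<Sum>i\<le>k. smooth_seminorm n U x (k - i) (fps_nth F i))"

section \<open>Frechet spaces and Frechet algebras\<close>

definition seminorm_on ::
  "('k::real_normed_field \<Rightarrow> 'v::ab_group_add \<Rightarrow> 'v) \<Rightarrow> 'v set \<Rightarrow> ('v \<Rightarrow> real) \<Rightarrow> bool" where
  "seminorm_on scl V q \<longleftrightarrow>
     (\<forall>v\<in>V. 0 \<le> q v) \<and>
     (\<forall>v\<in>V. \<forall>w\<in>V. q (v + w) \<le> q v + q w) \<and>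
     (\<forall>a. \<forall>v\<in>V. q (scl a v) = norm a * q v)"

definition frechet_space ::
  "('k::real_normed_field \<Rightarrow> 'v::ab_group_add \<Rightarrow> 'v) \<Rightarrow> 'v set \<Rightarrow> (nat \<Rightarrow> 'v \<Rightarrow> real) \<Rightarrow> bool" where
  "frechet_space scl V q \<longleftrightarrow>
     vector_space scl \<and> module.subspace scl V \<and>
     (\<forall>k. seminorm_on scl V (q k)) \<and>
     (\<forall>v\<in>V. (\<forall>k. q k v = 0) \<longrightarrow> v = 0) \<and>
     (\<forall>s. (\<forall>i. s i \<in> V) \<and>
          (\<forall>k. \<forall>\<epsilon>>0. \<exists>N. \<forall>i\<ge>N. \<forall>j\<ge>N. q k (s i - s j) < \<epsilon>) \<longrightarrow>
          (\<exists>v\<in>V. \<forall>k. (\<lambda>i. q k (s i - v)) \<longlonglongrightarrow> 0))"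

definition frechet_dist :: "(nat \<Rightarrow> 'v::ab_group_add \<Rightarrow> real) \<Rightarrow> 'v \<Rightarrow> 'v \<Rightarrow> real" where
  "frechet_dist q v w = (\<Sum>k. (1 / 2) ^ k * (q k (v - w) / (1 + q k (v - w))))"

definition frechet_algebra ::
  "('k::real_normed_field \<Rightarrow> 'v::ab_group_add \<Rightarrow> 'v) \<Rightarrow> 'v set \<Rightarrow> (nat \<Rightarrow> 'v \<Rightarrow> real) \<Rightarrow>
    ('v \<Rightarrow> 'v \<Rightarrow> 'v) \<Rightarrow> bool" where
  "frechet_algebra scl V q prd \<longleftrightarrow>
     frechet_space scl V q \<and>
     (\<forall>u\<in>V. \<forall>v\<in>V. prd u v \<in> V) \<and>
     (\<forall>u\<in>V. \<forall>v\<in>V. \<forall>w\<in>V. prd (prd u v) w = prd u (prd v w)) \<and>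
     (\<forall>u\<in>V. \<forall>v\<in>V. \<forall>w\<in>V. prd (u + v) w = prd u w + prd v w \<and>
                                prd w (u + v) = prd w u + prd w v) \<and>
     (\<forall>a. \<forall>u\<in>V. \<forall>v\<in>V. prd (scl a u) v = scl a (prd u v) \<and>
                         prd u (scl a v) = scl a (prd u v)) \<and>
     (\<forall>r s u v. (\<forall>i. r i \<in> V) \<and> (\<forall>i. s i \<in> V) \<and> u \<in> V \<and> v \<in> V \<and>
        (\<lambda>i. frechet_dist q (r i) u) \<longlonglongrightarrow> 0 \<and> (\<lambda>i. frechet_dist q (s i) v) \<longlonglongrightarrow> 0 \<longrightarrow>
        (\<lambda>i. frechet_dist q (prd (r i) (s i)) (prd u v)) \<longlonglongrightarrow> 0)"

end

theory Submission
  imports Defs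
begin

text \<open>
  Two things have to be shown: the formal functions are complete, and the product is continuous.

  Continuity comes from a single estimate. By \<open>\<hbar>\<close>-bilinearity the coefficient of \<open>\<hbar>\<^sup>m\<close> in
  \<open>F \<star> G\<close> is the finite sum of the \<open>C\<^sub>c(F\<^sub>a, G\<^sub>b)\<close> with \<open>a + b + c = m\<close>, where \<open>C\<^sub>0\<close> is the pointwise
  product (lemma \<open>star_nth\<close>). Since \<open>C\<^sub>c\<close> has order at most \<open>c\<close> in each argument, the
  \<open>l\<close>-th semi-norm of \<open>C\<^sub>c(f, g)\<close> is at most a constant times the product of the \<open>(l + c)\<close>-th
  semi-norms of \<open>f\<close> and \<open>g\<close> (lemma \<open>bidifferential_operator_bound\<close>). In the \<open>k\<close>-th semi-norm of
  \<open>F \<star> G\<close> these terms occur with \<open>l = k - m\<close>, so \<open>l + c = k - a - b\<close>, which is at most \<open>k - a\<close> and at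
  most \<open>k - b\<close>: exactly the orders up to which the \<open>k\<close>-th semi-norm controls \<open>F\<^sub>a\<close> and \<open>G\<^sub>b\<close>. Hence
  \<open>\<parallel>F \<star> G\<parallel>\<^sub>k \<le> M \<parallel>F\<parallel>\<^sub>k \<parallel>G\<parallel>\<^sub>k\<close> (lemma \<open>star_bound\<close>), and joint continuity follows as for any
  bounded bilinear map.

  Completeness is checked coefficient by coefficient, so it is a statement about smooth functions
  (lemma \<open>smooth_functions_complete\<close>). A Cauchy sequence has a pointwise limit, and over each member of
  the covering all derivatives in the coordinates chosen there converge uniformly, so the limit is smooth in
  these coordinates; smoothness in every other chart follows from the chain rule, because the
  transition maps are smooth.

  Both arguments need calculus in coordinates for functions whose smoothness is
  expressed by iterated partial derivatives along coordinate lines. Three facts carry it: the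
  chain rule (\<open>partial_chain_rule\<close>), the symmetry of mixed partial derivatives (\<open>partial_commute\<close>), and the
  smoothness of a limit (\<open>converges_smoothly_smooth\<close>). Symmetry is essential because smoothness
  concerns derivatives taken in every order, while the semi-norms only see those indexed by
  multi-indices.
\<close>

section \<open>Partial derivatives on open sets\<close>

text \<open>
  A neighbourhood in the product topology restricts only finitely many coordinates, and the coordinates
  from \<open>n\<close> on vanish anyway. This replaces balls, since the ambient function type carries no norm.
\<close>

lemma openin_Euclidean_space_box:
  assumes "openin (Euclidean_space n) S" "y \<in> S"
  obtains d where "d > 0" 
    "\<And>z. \<lbrakk>\<And>j. n \<le> j \<Longrightarrow> z j = 0; \<And>j. j < n \<Longrightarrow> \<bar>z j - y j\<bar> < d\<rbrakk> \<Longrightarrow> z \<in> S"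
proof -
  obtain T where T: "openin (powertop_real UNIV) T" "S = T \<inter> {x. \<forall>i\<ge>n. x i = 0}"
    using assms(1) unfolding Euclidean_space_def openin_subtopology by auto
  obtain X where X: "y \<in> (\<Pi>\<^sub>E i\<in>UNIV. X i)" "\<And>i. openin euclideanreal (X i)"
      "(\<Pi>\<^sub>E i\<in>UNIV. X i) \<subseteq> T"
    using product_topology_open_contains_basis[OF T(1), of y] assms(2) T(2) by auto
  have "\<exists>d>0. \<forall>t. \<bar>t - y j\<bar> < d \<longrightarrow> t \<in> X j" for j
  proof -
    have "open (X j)" "y j \<in> X j" using X(1) X(2)[of j] by (auto simp: PiE_iff)
    then show ?thesis unfolding open_dist dist_real_def by blast
  qed
  then obtain r where r: "\<And>j. r j > 0" "\<And>j t. \<bar>t - y j\<bar> < r j \<Longrightarrow> t \<in> X j"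
    by metis
  \<comment> \<open>The element \<open>1\<close> keeps the minimum meaningful for \<open>n = 0\<close>.\<close>
  define d where "d = Min (insert 1 (r ` {..<n}))"
  have "d > 0" unfolding d_def using r(1) by (subst Min_gr_iff) auto
  moreover have "z \<in> S" if z: "\<And>j. n \<le> j \<Longrightarrow> z j = 0" "\<And>j. j < n \<Longrightarrow> \<bar>z j - y j\<bar> < d" for z
  proof -
    have "z j \<in> X j" for j
    proof (cases "j < n")
      case True
      then have "d \<le> r j" unfolding d_def by (intro Min_le) auto
      then show ?thesis using r(2)[of "z j" j] z(2)[OF True] by linarith
    next
      case False
      then have "z j = y j" using z(1)[of j] assms(2) T(2) by auto
      then show ?thesis using r(1)[of j] r(2)[of "z j" j] by simp
    qed
    then have "z \<in> T" using X(3) by (auto simp: PiE_iff)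
    then show ?thesis using T(2) z(1) by auto
  qed
  ultimately show ?thesis using that by blast
qed

lemma openin_Euclidean_spaceD:
  assumes "openin (Euclidean_space n) S" "y \<in> S" "n \<le> j"
  shows "y j = 0"
  using openin_subset[OF assms(1)] assms(2,3) by (auto simp: topspace_Euclidean_space)

lemma openin_Euclidean_space_iff_open:
  "openin (Euclidean_space n) S \<longleftrightarrow> (\<exists>T. open T \<and> S = T \<inter> {x. \<forall>i\<ge>n. x i = 0})"
  unfolding Euclidean_space_def openin_subtopology euclidean_product_topology by simp

lemma openin_Euclidean_space_preimage:
  fixes h :: "(nat \<Rightarrow> real) \<Rightarrow> 'a::topological_space"
  assumes "openin (Euclidean_space n) S" "continuous_on S h" "open V"
  shows "openin (Euclidean_space n) (S \<inter> h -` V)"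
proof -
  obtain T where T: "open T" "S = T \<inter> {x. \<forall>i\<ge>n. x i = 0}"
    using assms(1) unfolding openin_Euclidean_space_iff_open by blast
  obtain B where B: "open B" "B \<inter> S = h -` V \<inter> S"
    using assms(2,3) unfolding continuous_on_open_invariant by blast
  have "S \<inter> h -` V = (B \<inter> T) \<inter> {x. \<forall>i\<ge>n. x i = 0}" using B T by auto
  then show ?thesis unfolding openin_Euclidean_space_iff_open using B(1) T(1) by blast
qed

lemma open_coordinate_line:
  assumes "openin (Euclidean_space n) S" "i < n" "y \<in> S"
  shows "open {t. y(i := t) \<in> S}"
proof -
  obtain T where T: "open T" "S = T \<inter> {x. \<forall>i\<ge>n. x i = 0}"
    using assms(1) unfolding openin_Euclidean_space_iff_open by blast
  have eq: "{t. y(i := t) \<in> S} = (\<lambda>t. y(i := t)) -` T"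
    using assms(2,3) T(2) by auto
  have "continuous_on UNIV (\<lambda>t. y(i := t))"
  proof (rule continuous_on_coordinatewise_then_product)
    show "continuous_on UNIV (\<lambda>t. (y(i := t)) l)" for l
      by (cases "l = i") auto
  qed
  then show ?thesis unfolding eq using T(1) by (simp add: open_vimage)
qed

text \<open>
  The differentiability condition in \<^const>\<open>smooth_on\<close>, for a single function. It is weaker than total
  differentiability, which is why the chain rule below asks for continuous derivatives.
\<close>

definition partially_differentiable ::
  "nat \<Rightarrow> (nat \<Rightarrow> real) set \<Rightarrow> ((nat \<Rightarrow> real) \<Rightarrow> 'k::real_normed_vector) \<Rightarrow> bool" where
  "partially_differentiable n S g \<longleftrightarrow>
     (\<forall>i<n. \<forall>y\<in>S. (\<lambda>t. g (y(i := t))) differentiable (at (y i)))"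

lemma has_partial:
  assumes "partially_differentiable n S g" "i < n" "y(i := t) \<in> S"
  shows "((\<lambda>s. g (y(i := s))) has_vector_derivative partial i g (y(i := t))) (at t)"
proof -
  have "(\<lambda>s. g ((y(i := t))(i := s))) differentiable (at ((y(i := t)) i))"
    using assms unfolding partially_differentiable_def by blast
  then have "(\<lambda>s. g (y(i := s))) differentiable (at t)" by simp
  then show ?thesis
    unfolding vector_derivative_works partial_def by simp
qed

lemma has_partial_at:
  assumes "partially_differentiable n S g" "i < n" "y \<in> S"
  shows "((\<lambda>s. g (y(i := s))) has_vector_derivative partial i g y) (at (y i))"
  using has_partial[of n S g i y "y i"] assms by simp

lemma partial_eqI:
  "((\<lambda>t. g (y(i := t))) has_vector_derivative D) (at (y i)) \<Longrightarrow> partial i g y = D"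
  unfolding partial_def by (rule vector_derivative_at)

lemma partially_differentiableI:
  assumes "\<And>i y. i < n \<Longrightarrow> y \<in> S \<Longrightarrow> ((\<lambda>t. g (y(i := t))) has_vector_derivative D i y) (at (y i))"
  shows "partially_differentiable n S g"
  unfolding partially_differentiable_def using assms differentiableI_vector by blast

text \<open>
  On an open set, partial derivatives depend only on the values in the set, because a coordinate line
  through a point of the set stays in it for a while. The congruence rules below all rest on this, and they
  matter because the identities between functions used later hold only on the image of a chart.
\<close>

lemma has_partial_transform:
  assumes "openin (Euclidean_space n) S" "i < n" "y \<in> S" "\<And>z. z \<in> S \<Longrightarrow> f z = g z"
    and "((\<lambda>t. f (y(i := t))) has_vector_derivative D) (at (y i))"
  shows "((\<lambda>t. g (y(i := t))) has_vector_derivative D) (at (y i))"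
  by (rule has_vector_derivative_transform_within_open[OF assms(5) open_coordinate_line[OF assms(1-3)]])
     (use assms in auto)

lemma partial_cong:
  assumes "openin (Euclidean_space n) S" "i < n" "y \<in> S" "\<And>z. z \<in> S \<Longrightarrow> f z = g z"
  shows "partial i f y = partial i g y"
proof -
  have "((\<lambda>t. f (y(i := t))) has_vector_derivative D) (at (y i)) \<longleftrightarrow>
        ((\<lambda>t. g (y(i := t))) has_vector_derivative D) (at (y i))" for D
    using has_partial_transform[OF assms(1-3), of f g] has_partial_transform[OF assms(1-3), of g f] assms(4)
    by metis
  then show ?thesis unfolding partial_def vector_derivative_def by simp
qed

lemma foldr_partial_cong:
  assumes "openin (Euclidean_space n) S" "set is \<subseteq> {..<n}" "y \<in> S" "\<And>z. z \<in> S \<Longrightarrow> f z = g z"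
  shows "foldr partial is f y = foldr partial is g y"
  using assms(2,3)
proof (induction "is" arbitrary: y)
  case (Cons i js)
  then show ?case using partial_cong[OF assms(1), of i y "foldr partial js f" "foldr partial js g"] by simp
qed (use assms(4) in simp)

lemma partially_differentiable_cong:
  fixes f g :: "(nat \<Rightarrow> real) \<Rightarrow> 'a::real_normed_vector"
  assumes "openin (Euclidean_space n) S" "\<And>z. z \<in> S \<Longrightarrow> f z = g z"
  shows "partially_differentiable n S f \<longleftrightarrow> partially_differentiable n S g"
proof -
  have "partially_differentiable n S g"
    if "partially_differentiable n S f" "\<And>z. z \<in> S \<Longrightarrow> f z = g z" for f g :: "(nat \<Rightarrow> real) \<Rightarrow> 'a"
  proof (rule partially_differentiableI)
    fix i y assume "i < n" "y \<in> S"
    from has_partial_transform[OF assms(1) this that(2) has_partial_at[OF that(1) this]]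
    show "((\<lambda>t. g (y(i := t))) has_vector_derivative partial i f y) (at (y i))" .
  qed
  from this[of f g] this[of g f] show ?thesis using assms(2) by auto
qed

section \<open>Finitely often differentiable functions\<close>

text \<open>
  Smoothness is a condition on all iterated derivatives at once. Splitting it into finite orders that
  are defined by recursion makes closure under products and compositions provable by induction on the
  order: one derivative of such an expression is a sum of expressions of the same kind.
\<close>

primrec Ck :: "nat \<Rightarrow> (nat \<Rightarrow> real) set \<Rightarrow> nat \<Rightarrow> ((nat \<Rightarrow> real) \<Rightarrow> 'k::real_normed_vector) \<Rightarrow> bool" where
  "Ck n S 0 g \<longleftrightarrow> continuous_on S g"
| "Ck n S (Suc k) g \<longleftrightarrow> continuous_on S g \<and> partially_differentiable n S g \<and>
     (\<forall>i<n. Ck n S k (partial i g))"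

lemma Ck_imp_continuous_on: "Ck n S k g \<Longrightarrow> continuous_on S g"
  by (cases k) auto

lemma Ck_cong:
  assumes "openin (Euclidean_space n) S" "\<And>z. z \<in> S \<Longrightarrow> f z = g z"
  shows "Ck n S k f \<longleftrightarrow> Ck n S k g"
  using assms(2)
proof (induction k arbitrary: f g)
  case 0
  then show ?case by (simp cong: continuous_on_cong)
next
  case (Suc k)
  have "Ck n S k (partial i f) \<longleftrightarrow> Ck n S k (partial i g)" if "i < n" for i
    using Suc partial_cong[OF assms(1) that] by blast
  moreover have "continuous_on S f = continuous_on S g" using Suc.prems by (simp cong: continuous_on_cong)
  ultimately show ?case using partially_differentiable_cong[OF assms(1), of f g] Suc.prems by auto
qed

lemma Ck_transform:
  assumes "openin (Euclidean_space n) S" "Ck n S k f" "\<And>z. z \<in> S \<Longrightarrow> g z = f z"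
  shows "Ck n S k g"
  using Ck_cong[OF assms(1), of g f k] assms(2,3) by simp

lemma Ck_SucD: "Ck n S (Suc k) g \<Longrightarrow> Ck n S k g"
  by (induction k arbitrary: g) auto

lemma Ck_subset: "Ck n S k g \<Longrightarrow> T \<subseteq> S \<Longrightarrow> Ck n T k g"
  by (induction k arbitrary: g) (auto intro: continuous_on_subset simp: partially_differentiable_def)

lemma smooth_on_partial:
  assumes "smooth_on n S g" "i < n"
  shows "smooth_on n S (partial i g)"
proof -
  have "continuous_on S (foldr partial js (partial i g)) \<and>
     (\<forall>l<n. \<forall>y\<in>S. (\<lambda>t. foldr partial js (partial i g) (y(l := t))) differentiable (at (y l)))"
    if "set js \<subseteq> {..<n}" for js
    using assms(1)[unfolded smooth_on_def, rule_format, of "js @ [i]"] assms(2) that by simp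
  then show ?thesis unfolding smooth_on_def by blast
qed

lemma smooth_onD:
  assumes "smooth_on n S g"
  shows "continuous_on S g" "partially_differentiable n S g"
  using assms[unfolded smooth_on_def, rule_format, of "[]"] by (auto simp: partially_differentiable_def)

lemma smooth_on_foldr_partial:
  assumes "smooth_on n S g" "set is \<subseteq> {..<n}"
  shows "smooth_on n S (foldr partial is g)"
  using assms(2)
proof (induction "is")
  case (Cons i js)
  then show ?case by (simp add: smooth_on_partial)
qed (use assms in simp)

text \<open>
  The recursion of \<^const>\<open>Ck\<close> peels off the derivative that is applied first, which is the last entry of a list
  in \<^const>\<open>smooth_on\<close>.
\<close>

lemma smooth_on_iff_Ck: "smooth_on n S g \<longleftrightarrow> (\<forall>k. Ck n S k g)"
proof
  assume "smooth_on n S g"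
  then have "Ck n S k g" for k
    by (induction k arbitrary: g) (simp_all add: smooth_onD smooth_on_partial)
  then show "\<forall>k. Ck n S k g" by blast
next
  assume a: "\<forall>k. Ck n S k g"
  have step: "\<forall>k. Ck n S k (foldr partial is g)" if "set is \<subseteq> {..<n}" for "is"
    using that
  proof (induction "is")
    case (Cons i js)
    then have "Ck n S (Suc k) (foldr partial js g)" for k by (simp del: Ck.simps)
    then show ?case using Cons.prems by simp
  qed (use a in simp)
  have "continuous_on S h \<and> partially_differentiable n S h" if "\<forall>k. Ck n S k h" for h :: "(nat \<Rightarrow> real) \<Rightarrow> 'a"
    using that[rule_format, of 1] by simp
  then show "smooth_on n S g"
    using step unfolding smooth_on_def partially_differentiable_def by blast
qed

lemma Ck_const: "Ck n S k (\<lambda>_. c)"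
proof (induction k arbitrary: c)
  case (Suc k)
  have "partial i (\<lambda>_. c) = (\<lambda>_. 0)" for i unfolding partial_def by simp
  then show ?case using Suc by (auto simp: partially_differentiable_def)
qed simp

lemma partial_add:
  assumes "partially_differentiable n S f" "partially_differentiable n S g" "i < n" "y \<in> S"
  shows "partial i (\<lambda>y. f y + g y) y = partial i f y + partial i g y"
  by (intro partial_eqI has_vector_derivative_add has_partial_at[OF assms(1,3,4)] has_partial_at[OF assms(2,3,4)])

lemma Ck_add:
  assumes "openin (Euclidean_space n) S" "Ck n S k f" "Ck n S k g"
  shows "Ck n S k (\<lambda>y. f y + g y)"
  using assms(2,3)
proof (induction k arbitrary: f g)
  case 0
  then show ?case by (simp add: continuous_on_add)
next
  case (Suc k)
  have "Ck n S k (partial i (\<lambda>y. f y + g y))" if "i < n" for i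
  proof -
    have "Ck n S k (\<lambda>y. partial i f y + partial i g y)" using Suc that by simp
    then show ?thesis
      by (rule Ck_transform[OF assms(1)]) (rule partial_add, use Suc.prems that in auto)
  qed
  moreover have "partially_differentiable n S (\<lambda>y. f y + g y)"
    using Suc.prems by (auto simp: partially_differentiable_def intro: differentiable_add)
  ultimately show ?case using Suc.prems by (simp add: continuous_on_add)
qed

lemma (in bounded_bilinear) has_partial_prod:
  assumes "partially_differentiable n S f" "partially_differentiable n S g" "i < n" "y \<in> S"
  shows "((\<lambda>t. prod (f (y(i := t))) (g (y(i := t)))) has_vector_derivative
           (prod (f y) (partial i g y) + prod (partial i f y) (g y))) (at (y i))"
  using has_vector_derivative[OF has_partial_at[OF assms(1,3,4)] has_partial_at[OF assms(2,3,4)]] by simp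

text \<open>
  Stated for all bounded bilinear maps because both the product of scalars and the scaling of a vector by
  a real number are needed; the latter occurs in the chain rule.
\<close>

lemma (in bounded_bilinear) Ck_prod:
  assumes "openin (Euclidean_space n) S" "Ck n S k f" "Ck n S k g"
  shows "Ck n S k (\<lambda>y. prod (f y) (g y))"
  using assms(2,3)
proof (induction k arbitrary: f g)
  case 0
  then show ?case by (simp add: continuous_on)
next
  case (Suc k)
  note pd = has_partial_prod[of n S f g]
  have "Ck n S k (partial i (\<lambda>y. prod (f y) (g y)))" if "i < n" for i
  proof -
    have "Ck n S k (\<lambda>y. prod (f y) (partial i g y) + prod (partial i f y) (g y))"
      by (intro Ck_add[OF assms(1)] Suc.IH) (use Suc.prems that in \<open>auto dest: Ck_SucD simp del: Ck.simps\<close>, auto)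
    moreover have "partial i (\<lambda>y. prod (f y) (g y)) y = prod (f y) (partial i g y) + prod (partial i f y) (g y)"
      if "y \<in> S" for y
      using pd[OF _ _ \<open>i < n\<close> that] Suc.prems by (intro partial_eqI) simp
    ultimately show ?thesis by (rule Ck_transform[OF assms(1)])
  qed
  moreover have "partially_differentiable n S (\<lambda>y. prod (f y) (g y))"
    using pd Suc.prems by (intro partially_differentiableI) auto
  ultimately show ?case using Suc.prems by (simp add: continuous_on)
qed

section \<open>The chain rule\<close>

lemma continuous_at_box:
  fixes h :: "(nat \<Rightarrow> real) \<Rightarrow> 'a::metric_space"
  assumes "openin (Euclidean_space n) S" "continuous_on S h" "y \<in> S" "e > 0"
  obtains d where "d > 0"
    "\<And>z. \<lbrakk>\<And>j. n \<le> j \<Longrightarrow> z j = 0; \<And>j. j < n \<Longrightarrow> \<bar>z j - y j\<bar> < d\<rbrakk> \<Longrightarrow> z \<in> S \<and> dist (h z) (h y) < e"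
proof -
  have "openin (Euclidean_space n) (S \<inter> h -` ball (h y) e)"
    using assms by (intro openin_Euclidean_space_preimage) auto
  then obtain d where "d > 0"
    "\<And>z. \<lbrakk>\<And>j. n \<le> j \<Longrightarrow> z j = 0; \<And>j. j < n \<Longrightarrow> \<bar>z j - y j\<bar> < d\<rbrakk> \<Longrightarrow> z \<in> S \<inter> h -` ball (h y) e"
    using assms by (elim openin_Euclidean_space_box[where y = y]) auto
  then show ?thesis using that[of d] by (auto simp: dist_commute)
qed

text \<open>
  One step of the telescoping sum for the chain rule: the coordinates of a curve before the \<open>k\<close>-th have
  already moved, the later ones rest at time \<open>t0\<close>, and the \<open>k\<close>-th moves now. Only the \<open>k\<close>-th partial derivative
  of \<open>g\<close> enters. The mean value inequality along the segment in direction \<open>k\<close> bounds the deviation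
  from the linear term, because by continuity that partial derivative is near its value at the base point
  throughout the segment.
\<close>

lemma has_vector_derivative_coordinate_step:
  fixes g :: "(nat \<Rightarrow> real) \<Rightarrow> 'k::real_normed_vector" and \<gamma> :: "real \<Rightarrow> nat \<Rightarrow> real"
  assumes S: "openin (Euclidean_space n) S" and g: "partially_differentiable n S g"
    and cont: "continuous_on S (partial k g)" and k: "k < n"
    and y: "\<gamma> t0 \<in> S" and \<gamma>: "\<And>j. j < n \<Longrightarrow> ((\<lambda>t. \<gamma> t j) has_vector_derivative v j) (at t0)"
  shows "((\<lambda>t. g (\<lambda>j. if j < Suc k then \<gamma> t j else \<gamma> t0 j) - g (\<lambda>j. if j < k then \<gamma> t j else \<gamma> t0 j))
           has_vector_derivative v k *\<^sub>R partial k g (\<gamma> t0)) (at t0)"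
proof -
  define D where "D = partial k g (\<gamma> t0)"
  define z where "z = (\<lambda>t b j. if j < k then \<gamma> t j else if j = k then b else \<gamma> t0 j)"
  define \<phi> where "\<phi> = (\<lambda>t. g (z t (\<gamma> t k)) - g (z t (\<gamma> t0 k)) - (\<gamma> t k - \<gamma> t0 k) *\<^sub>R D)"
  have upd: "(z t b)(k := b') = z t b'" for t b b' unfolding z_def by auto
  have z_eq: "(\<lambda>j. if j < Suc k then \<gamma> t j else \<gamma> t0 j) = z t (\<gamma> t k)"
     "(\<lambda>j. if j < k then \<gamma> t j else \<gamma> t0 j) = z t (\<gamma> t0 k)" for t
    unfolding z_def by (auto simp: less_Suc_eq)
  have \<phi>_bound: "\<forall>\<^sub>F t in nhds t0. norm (\<phi> t) \<le> e * \<bar>t - t0\<bar>" if "e > 0" for e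
  proof -
    \<comment> \<open>The mean value inequality costs \<open>2 * e'\<close>, the change of base point another \<open>e'\<close>, and the \<open>k\<close>-th coordinate grows at most at rate \<open>\<bar>v k\<bar> + 1\<close>.\<close>
    define e' where "e' = e / (3 * (\<bar>v k\<bar> + 1))"
    have e': "e' > 0" using that unfolding e'_def by simp
    obtain d where d: "d > 0" and near:
      "\<And>z. \<lbrakk>\<And>j. n \<le> j \<Longrightarrow> z j = 0; \<And>j. j < n \<Longrightarrow> \<bar>z j - \<gamma> t0 j\<bar> < d\<rbrakk> \<Longrightarrow>
          z \<in> S \<and> dist (partial k g z) D < e'"
      using continuous_at_box[OF S cont y e'] unfolding D_def by metis
    have "\<forall>\<^sub>F t in nhds t0. \<bar>\<gamma> t j - \<gamma> t0 j\<bar> < d" if "j < n" for j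
    proof -
      have "isCont (\<lambda>t. \<gamma> t j) t0" using \<gamma>[OF that] has_vector_derivative_continuous by blast
      then have "((\<lambda>t. \<gamma> t j) \<longlongrightarrow> \<gamma> t0 j) (nhds t0)"
        using tendsto_at_iff_tendsto_nhds[of "\<lambda>t. \<gamma> t j" t0] by (simp add: isCont_def)
      from tendstoD[OF this d] show ?thesis by (simp add: dist_real_def)
    qed
    then have "\<forall>\<^sub>F t in nhds t0. \<forall>j\<in>{..<n}. \<bar>\<gamma> t j - \<gamma> t0 j\<bar> < d"
      by (intro eventually_ball_finite) auto
    moreover have "\<forall>\<^sub>F t in nhds t0. \<bar>\<gamma> t k - \<gamma> t0 k\<bar> \<le> (\<bar>v k\<bar> + 1) * \<bar>t - t0\<bar>"
    proof -
      have "((\<lambda>t. \<gamma> t k) has_derivative (\<lambda>h. h *\<^sub>R v k)) (at t0)"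
        using \<gamma>[OF k] by (simp add: has_vector_derivative_def)
      then obtain r where r: "r > 0"
        "\<And>t. norm (t - t0) < r \<Longrightarrow> norm (\<gamma> t k - \<gamma> t0 k - (t - t0) *\<^sub>R v k) \<le> 1 * norm (t - t0)"
        unfolding has_derivative_at_alt by (metis zero_less_one)
      have "\<bar>\<gamma> t k - \<gamma> t0 k\<bar> \<le> (\<bar>v k\<bar> + 1) * \<bar>t - t0\<bar>" if "dist t t0 < r" for t
      proof -
        have "\<bar>\<gamma> t k - \<gamma> t0 k - (t - t0) * v k\<bar> \<le> \<bar>t - t0\<bar>"
          using r(2)[of t] that by (simp add: dist_real_def)
        moreover have "\<bar>(t - t0) * v k\<bar> = \<bar>v k\<bar> * \<bar>t - t0\<bar>" by (simp add: abs_mult)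
        ultimately show ?thesis by (simp add: algebra_simps abs_le_iff) linarith
      qed
      then show ?thesis using r(1) unfolding eventually_nhds_metric by blast
    qed
    ultimately show ?thesis
    proof eventually_elim
      case (elim t)
      define I where "I = {b. \<bar>b - \<gamma> t0 k\<bar> < d}"
      have I: "z t b \<in> S \<and> dist (partial k g (z t b)) D < e'" if "b \<in> I" for b
        by (rule near) (use that elim d k openin_Euclidean_spaceD[OF S y] in \<open>auto simp: z_def I_def\<close>)
      have in_I: "\<gamma> t0 k \<in> I" "\<gamma> t k \<in> I" using d elim(1) k unfolding I_def by auto
      have "convex I"
      proof -
        have "I = ball (\<gamma> t0 k) d" unfolding I_def by (auto simp: dist_real_def abs_minus_commute)
        then show ?thesis by simp
      qed
      have der: "((\<lambda>b. g (z t b)) has_vector_derivative partial k g (z t b)) (at b within I)" if "b \<in> I" for b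
        using has_partial[OF g k, of "z t b" b] I[OF that] unfolding upd
        by (auto intro: has_vector_derivative_at_within)
      have "norm (g (z t (\<gamma> t k)) - g (z t (\<gamma> t0 k)) - (\<gamma> t k - \<gamma> t0 k) *\<^sub>R partial k g (z t (\<gamma> t0 k)))
           \<le> norm (\<gamma> t k - \<gamma> t0 k) * (2 * e')"
      proof (rule vector_differentiable_bound_linearization[where S = I and f = "\<lambda>b. g (z t b)"
            and f' = "\<lambda>b. partial k g (z t b)" and ?x0.0 = "\<gamma> t0 k", OF der])
        show "closed_segment (\<gamma> t0 k) (\<gamma> t k) \<subseteq> I"
          by (rule closed_segment_subset[OF in_I \<open>convex I\<close>])
        fix b assume "b \<in> I"
        then have "dist (partial k g (z t b)) D < e'" "dist (partial k g (z t (\<gamma> t0 k))) D < e'"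
          using I in_I by auto
        then have "dist (partial k g (z t b)) (partial k g (z t (\<gamma> t0 k))) \<le> 2 * e'"
          using dist_triangle2[of "partial k g (z t b)" "partial k g (z t (\<gamma> t0 k))" D] by linarith
        then show "norm (partial k g (z t b) - partial k g (z t (\<gamma> t0 k))) \<le> 2 * e'"
          by (simp add: dist_norm)
      qed (use in_I in auto)
      moreover have "norm ((\<gamma> t k - \<gamma> t0 k) *\<^sub>R (partial k g (z t (\<gamma> t0 k)) - D)) \<le> \<bar>\<gamma> t k - \<gamma> t0 k\<bar> * e'"
      proof -
        have "norm (partial k g (z t (\<gamma> t0 k)) - D) \<le> e'"
          using I[OF in_I(1)] by (simp add: dist_norm)
        then show ?thesis by (simp add: mult_left_mono)
      qed
      moreover have "\<phi> t = (g (z t (\<gamma> t k)) - g (z t (\<gamma> t0 k)) - (\<gamma> t k - \<gamma> t0 k) *\<^sub>R partial k g (z t (\<gamma> t0 k)))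
          + (\<gamma> t k - \<gamma> t0 k) *\<^sub>R (partial k g (z t (\<gamma> t0 k)) - D)"
        unfolding \<phi>_def by (simp add: algebra_simps)
      ultimately have "norm (\<phi> t) \<le> \<bar>\<gamma> t k - \<gamma> t0 k\<bar> * (2 * e') + \<bar>\<gamma> t k - \<gamma> t0 k\<bar> * e'"
        by (simp only: real_norm_def norm_triangle_mono)
      also have "\<dots> = \<bar>\<gamma> t k - \<gamma> t0 k\<bar> * (3 * e')" by simp
      also have "\<dots> \<le> ((\<bar>v k\<bar> + 1) * \<bar>t - t0\<bar>) * (3 * e')"
        using elim(2) e' by (intro mult_right_mono) auto
      also have "\<dots> = e * \<bar>t - t0\<bar>"
      proof -
        have "(\<bar>v k\<bar> + 1) * (3 * e') = e" unfolding e'_def by (simp add: add_nonneg_eq_0_iff field_simps)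
        then show ?thesis by (metis mult.commute mult.left_commute)
      qed
      finally show ?case .
    qed
  qed
  have "\<phi> t0 = 0" unfolding \<phi>_def by simp
  have "(\<phi> has_derivative (\<lambda>h. 0)) (at t0)"
    unfolding has_derivative_at_alt
  proof (intro conjI allI impI)
    fix e :: real assume "e > 0"
    then show "\<exists>d>0. \<forall>t. norm (t - t0) < d \<longrightarrow> norm (\<phi> t - \<phi> t0 - 0) \<le> e * norm (t - t0)"
      using \<phi>_bound[of e] \<open>\<phi> t0 = 0\<close> unfolding eventually_nhds_metric by (auto simp: dist_real_def)
  qed simp
  then have "(\<phi> has_vector_derivative 0) (at t0)" by (simp add: has_vector_derivative_def)
  moreover have "((\<lambda>t. (\<gamma> t k - \<gamma> t0 k) *\<^sub>R D) has_vector_derivative v k *\<^sub>R D) (at t0)"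
    using \<gamma>[OF k] by (auto intro!: derivative_eq_intros simp: has_real_derivative_iff_has_vector_derivative)
  ultimately have "((\<lambda>t. \<phi> t + (\<gamma> t k - \<gamma> t0 k) *\<^sub>R D) has_vector_derivative 0 + v k *\<^sub>R D) (at t0)"
    by (rule has_vector_derivative_add)
  then show ?thesis unfolding z_eq \<phi>_def D_def by simp
qed

text \<open>
  Moving one coordinate after the other turns the increment of \<open>g\<close> along the curve into a telescoping
  sum of coordinate steps. Continuity of the partial derivatives cannot be dropped: without it, a
  partially differentiable function may fail to be differentiable along a curve.
\<close>

lemma partial_chain_rule:
  fixes g :: "(nat \<Rightarrow> real) \<Rightarrow> 'k::real_normed_vector" and \<gamma> :: "real \<Rightarrow> nat \<Rightarrow> real"
  assumes S: "openin (Euclidean_space n) S" and g: "partially_differentiable n S g"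
    and cont: "\<And>k. k < n \<Longrightarrow> continuous_on S (partial k g)"
    and N: "open N" "t0 \<in> N" "\<And>t. t \<in> N \<Longrightarrow> \<gamma> t \<in> S"
    and \<gamma>: "\<And>j. j < n \<Longrightarrow> ((\<lambda>t. \<gamma> t j) has_vector_derivative v j) (at t0)"
  shows "((\<lambda>t. g (\<gamma> t)) has_vector_derivative (\<Sum>k<n. v k *\<^sub>R partial k g (\<gamma> t0))) (at t0)"
proof -
  define z where "z = (\<lambda>k t j. if j < k then \<gamma> t j else \<gamma> t0 j)"
  have "((\<lambda>t. \<Sum>k<n. g (z (Suc k) t) - g (z k t)) has_vector_derivative
      (\<Sum>k<n. v k *\<^sub>R partial k g (\<gamma> t0))) (at t0)"
    unfolding z_def
    by (intro has_vector_derivative_sum has_vector_derivative_coordinate_step[OF S g])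
       (use cont N \<gamma> in auto)
  then have "((\<lambda>t. (\<Sum>k<n. g (z (Suc k) t) - g (z k t)) + g (\<gamma> t0)) has_vector_derivative
      (\<Sum>k<n. v k *\<^sub>R partial k g (\<gamma> t0))) (at t0)"
    by (simp add: has_vector_derivative_add_const)
  then show ?thesis
  proof (rule has_vector_derivative_transform_within_open[OF _ N(1,2)])
    fix t assume "t \<in> N"
    then have "z n t = \<gamma> t"
      using openin_Euclidean_spaceD[OF S N(3)] N(2) unfolding z_def by (auto simp: fun_eq_iff not_less)
    moreover have "z 0 t = \<gamma> t0" unfolding z_def by simp
    ultimately show "(\<Sum>k<n. g (z (Suc k) t) - g (z k t)) + g (\<gamma> t0) = g (\<gamma> t)"
      using sum_lessThan_telescope[of "\<lambda>k. g (z k t)" n] by simp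
  qed
qed

lemma Ck_sum:
  assumes "openin (Euclidean_space n) S" "\<And>j. j \<in> J \<Longrightarrow> Ck n S k (f j)"
  shows "Ck n S k (\<lambda>y. \<Sum>j\<in>J. f j y)"
  using assms(2)
proof (induction J rule: infinite_finite_induct)
  case (insert j J)
  then show ?case using Ck_add[OF assms(1), of k "f j" "\<lambda>y. \<Sum>j\<in>J. f j y"] by simp
qed (simp_all add: Ck_const)

text \<open>
  By the chain rule a derivative of the composition is a sum of products of a derivative of a component
  of \<open>\<phi>\<close> and a composition with a derivative of \<open>g\<close>, so the order goes down by one and induction applies.
\<close>

lemma Ck_compose:
  fixes g :: "(nat \<Rightarrow> real) \<Rightarrow> 'k::real_normed_vector" and \<phi> :: "(nat \<Rightarrow> real) \<Rightarrow> nat \<Rightarrow> real"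
  assumes S: "openin (Euclidean_space n) S" and T: "openin (Euclidean_space n) T"
    and \<phi>: "\<And>y. y \<in> T \<Longrightarrow> \<phi> y \<in> S" "\<And>j. j < n \<Longrightarrow> Ck n T k (\<lambda>y. \<phi> y j)"
    and g: "Ck n S k g"
  shows "Ck n T k (\<lambda>y. g (\<phi> y))"
proof -
  have "continuous_on T \<phi>"
  proof (rule continuous_on_coordinatewise_then_product)
    fix j
    show "continuous_on T (\<lambda>y. \<phi> y j)"
    proof (cases "j < n")
      case True
      then show ?thesis using \<phi>(2) Ck_imp_continuous_on by blast
    next
      case False
      then have "continuous_on T (\<lambda>y. \<phi> y j) \<longleftrightarrow> continuous_on T (\<lambda>_. 0 :: real)"
        using openin_Euclidean_spaceD[OF S \<phi>(1)] by (intro continuous_on_cong) auto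
      then show ?thesis by simp
    qed
  qed
  then have cont: "continuous_on T (\<lambda>y. h (\<phi> y))" if "continuous_on S h" for h :: "_ \<Rightarrow> 'k"
    using continuous_on_compose2[OF that] \<phi>(1) by blast
  show ?thesis
    using \<phi>(2) g
  proof (induction k arbitrary: g)
    case 0
    then show ?case using cont by simp
  next
    case (Suc k)
    have der: "((\<lambda>t. g (\<phi> (y(i := t)))) has_vector_derivative
        (\<Sum>j<n. partial i (\<lambda>y. \<phi> y j) y *\<^sub>R partial j g (\<phi> y))) (at (y i))" if "i < n" "y \<in> T" for i y
    proof -
      have "((\<lambda>t. g (\<phi> (y(i := t)))) has_vector_derivative
        (\<Sum>j<n. partial i (\<lambda>y. \<phi> y j) y *\<^sub>R partial j g (\<phi> (y(i := y i))))) (at (y i))"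
      proof (rule partial_chain_rule[OF S, where \<gamma> = "\<lambda>t. \<phi> (y(i := t))"])
        show "partially_differentiable n S g" using Suc.prems by simp
        show "continuous_on S (partial j g)" if "j < n" for j
          using Suc.prems that by (auto intro: Ck_imp_continuous_on)
        show "open {t. y(i := t) \<in> T}" by (rule open_coordinate_line[OF T that])
        show "((\<lambda>t. \<phi> (y(i := t)) j) has_vector_derivative partial i (\<lambda>y. \<phi> y j) y) (at (y i))"
          if "j < n" for j
          using has_partial_at[of n T "\<lambda>y. \<phi> y j" i y] Suc.prems(1)[OF that] \<open>i < n\<close> \<open>y \<in> T\<close> by simp
        show "\<phi> (y(i := t)) \<in> S" if "t \<in> {t. y(i := t) \<in> T}" for t
          using \<phi>(1) that by blast
      qed (use that in auto)
      then show ?thesis by simp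
    qed
    have "Ck n T k (partial i (\<lambda>y. g (\<phi> y)))" if "i < n" for i
    proof (rule Ck_transform[OF T])
      show "Ck n T k (\<lambda>y. \<Sum>j<n. partial i (\<lambda>y. \<phi> y j) y *\<^sub>R partial j g (\<phi> y))"
      proof (intro Ck_sum[OF T] bounded_bilinear.Ck_prod[OF bounded_bilinear_scaleR T])
        fix j assume "j \<in> {..<n}"
        then show "Ck n T k (partial i (\<lambda>y. \<phi> y j))" using Suc.prems(1)[of j] that by simp
        show "Ck n T k (\<lambda>y. partial j g (\<phi> y))"
          using Suc.prems(2) \<open>j \<in> {..<n}\<close> by (intro Suc.IH Ck_SucD[OF Suc.prems(1)]) auto
      qed
    qed (use der that in \<open>auto intro: partial_eqI\<close>)
    then show ?case using der Suc.prems(2) cont by (auto intro!: partially_differentiableI)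
  qed
qed

section \<open>Locality of differentiability\<close>

lemma continuous_on_local:
  fixes f :: "(nat \<Rightarrow> real) \<Rightarrow> 'a::topological_space"
  assumes S: "openin (Euclidean_space n) S"
    and loc: "\<And>y. y \<in> S \<Longrightarrow> \<exists>T. openin (Euclidean_space n) T \<and> y \<in> T \<and> continuous_on T f"
  shows "continuous_on S f"
  unfolding continuous_on_eq_continuous_within
proof
  fix y assume y: "y \<in> S"
  obtain T where T: "openin (Euclidean_space n) T" "y \<in> T" "continuous_on T f" using loc[OF y] by blast
  obtain B where B: "open B" "T = B \<inter> {x. \<forall>i\<ge>n. x i = 0}"
    using T(1) unfolding openin_Euclidean_space_iff_open by blast
  have "S \<inter> B \<subseteq> T" using openin_Euclidean_spaceD[OF S] B(2) by auto
  then have "continuous (at y within (S \<inter> B)) f"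
    using T(2,3) B y by (meson Int_iff continuous_on_eq_continuous_within continuous_on_subset)
  moreover have "at y within (S \<inter> B) = at y within S"
    using B T(2) by (intro at_within_nhd[of y B]) auto
  ultimately show "continuous (at y within S) f" by simp
qed

lemma Ck_local:
  assumes S: "openin (Euclidean_space n) S"
    and loc: "\<And>y. y \<in> S \<Longrightarrow> \<exists>T. openin (Euclidean_space n) T \<and> y \<in> T \<and> Ck n T k f"
  shows "Ck n S k f"
  using loc
proof (induction k arbitrary: f)
  case 0
  then show ?case unfolding Ck.simps by (rule continuous_on_local[OF S])
next
  case (Suc k)
  have "partially_differentiable n S f"
    using Suc.prems unfolding partially_differentiable_def Ck.simps by blast
  moreover have "continuous_on S f"
    using Suc.prems by (intro continuous_on_local[OF S]) (meson Ck.simps(2))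
  moreover have "Ck n S k (partial i f)" if "i < n" for i
    using Suc.prems that by (intro Suc.IH) (meson Ck.simps(2))
  ultimately show ?case by simp
qed

section \<open>Symmetry of mixed partial derivatives\<close>

text \<open>
  The increment of \<open>g\<close> in direction \<open>j\<close> is the integral of \<open>\<partial>\<^sub>j g\<close>. Differentiating under the integral in
  direction \<open>i\<close> shows that the increment of \<open>\<partial>\<^sub>i g\<close> in direction \<open>j\<close> is the integral of \<open>\<partial>\<^sub>i \<partial>\<^sub>j g\<close>, and
  differentiating that in direction \<open>j\<close> gives the claim. The integrals make this work for values in any
  Banach space.
\<close>

lemma partial_commute:
  fixes g :: "(nat \<Rightarrow> real) \<Rightarrow> 'k::banach"
  assumes S: "openin (Euclidean_space n) S" and g: "partially_differentiable n S g"
    and gj: "continuous_on S (partial j g)" "partially_differentiable n S (partial j g)"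
    and gij: "continuous_on S (partial i (partial j g))"
    and ij: "i < n" "j < n" and y: "y \<in> S"
  shows "partial j (partial i g) y = partial i (partial j g) y"
proof (cases "i = j")
  case False
  obtain d where d: "d > 0" and box:
    "\<And>z. \<lbrakk>\<And>j. n \<le> j \<Longrightarrow> z j = 0; \<And>j. j < n \<Longrightarrow> \<bar>z j - y j\<bar> < d\<rbrakk> \<Longrightarrow> z \<in> S"
    using openin_Euclidean_space_box[OF S y] by metis
  define Q where "Q = (\<lambda>s t. y(i := s, j := t))"
  define U where "U = {y i - d <..< y i + d}"
  define a where "a = y j - d / 2"
  define b where "b = y j + d / 2"
  have ab: "a < y j" "y j < b" using d unfolding a_def b_def by auto
  have Q: "Q s t \<in> S" if "s \<in> U" "t \<in> {a..b}" for s t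
  proof (rule box)
    show "Q s t l = 0" if "n \<le> l" for l
      using openin_Euclidean_spaceD[OF S y that] ij that unfolding Q_def by auto
    show "\<bar>Q s t l - y l\<bar> < d" if "l < n" for l
      using \<open>s \<in> U\<close> \<open>t \<in> {a..b}\<close> d unfolding Q_def U_def a_def b_def by (auto simp: abs_less_iff)
  qed
  have Q_upd: "(Q s t)(j := t') = Q s t'" "(Q s t)(i := s') = Q s' t" "Q s t i = s" "Q s t j = t" for s s' t t'
    using False unfolding Q_def by (auto simp: fun_eq_iff)
  have Qy: "Q (y i) t = y(j := t)" for t unfolding Q_def by auto
  have contQ: "continuous_on X (\<lambda>p. Q (fst p) (snd p))" for X
  proof (rule continuous_on_coordinatewise_then_product)
    show "continuous_on X (\<lambda>p. Q (fst p) (snd p) l)" for l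
      using False unfolding Q_def by (cases "l = j"; cases "l = i") (auto intro!: continuous_intros)
  qed
  have contQ2: "continuous_on X (Q s)" for X s
  proof -
    have "continuous_on X (\<lambda>t. (s, t))" by (intro continuous_intros)
    then show ?thesis using continuous_on_compose2[OF contQ[of UNIV], of X "\<lambda>t. (s, t)"] by simp
  qed
  have U: "open U" "y i \<in> U" "convex U" using d unfolding U_def by auto
  \<comment> \<open>the fundamental theorem of calculus in direction \<open>j\<close>\<close>
  have ftc: "((\<lambda>\<tau>. partial j g (Q s \<tau>)) has_integral (g (Q s t) - g (Q s a))) {a..t}"
    if "s \<in> U" "t \<in> {a..b}" for s t
  proof (rule fundamental_theorem_of_calculus)
    fix \<tau> assume "\<tau> \<in> {a..t}"
    then have "Q s \<tau> \<in> S" using Q that by auto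
    then show "((\<lambda>\<tau>. g (Q s \<tau>)) has_vector_derivative partial j g (Q s \<tau>)) (at \<tau> within {a..t})"
      using has_partial[OF g ij(2), of "Q s \<tau>" \<tau>] by (auto simp: Q_upd intro: has_vector_derivative_at_within)
  qed (use that in auto)
  have "((\<lambda>s. integral (cbox a t) (\<lambda>\<tau>. partial j g (Q s \<tau>))) has_vector_derivative
      integral (cbox a t) (\<lambda>\<tau>. partial i (partial j g) (Q (y i) \<tau>))) (at (y i) within U)"
    if t: "t \<in> {a..b}" for t
  proof (rule leibniz_rule_vector_derivative[where fx = "\<lambda>s \<tau>. partial i (partial j g) (Q s \<tau>)"])
    fix s \<tau> assume s: "s \<in> U" and "\<tau> \<in> cbox a t"
    then have "Q s \<tau> \<in> S" using Q t by auto
    then show "((\<lambda>s. partial j g (Q s \<tau>)) has_vector_derivative partial i (partial j g) (Q s \<tau>)) (at s within U)"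
      using has_partial[OF gj(2) ij(1), of "Q s \<tau>" s] by (auto simp: Q_upd intro: has_vector_derivative_at_within)
  next
    show "(\<lambda>\<tau>. partial j g (Q s \<tau>)) integrable_on cbox a t" if "s \<in> U" for s
      using ftc[OF that t] by auto
    have "continuous_on (U \<times> cbox a t) (\<lambda>p. partial i (partial j g) (Q (fst p) (snd p)))"
      by (rule continuous_on_compose2[OF gij contQ]) (use Q t in auto)
    then show "continuous_on (U \<times> cbox a t) (\<lambda>(s, \<tau>). partial i (partial j g) (Q s \<tau>))"
      by (simp add: case_prod_unfold)
  qed (use U in auto)
  \<comment> \<open>differentiation under the integral in direction \<open>i\<close>\<close>
  then have leibniz: "((\<lambda>s. integral {a..t} (\<lambda>\<tau>. partial j g (Q s \<tau>))) has_vector_derivative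
      integral {a..t} (\<lambda>\<tau>. partial i (partial j g) (Q (y i) \<tau>))) (at (y i))"
    if "t \<in> {a..b}" for t
    using that U by (simp add: at_within_open[OF U(2,1)])
  have eq: "partial i g (Q (y i) t) - partial i g (Q (y i) a) =
      integral {a..t} (\<lambda>\<tau>. partial i (partial j g) (Q (y i) \<tau>))" if t: "t \<in> {a..b}" for t
  proof -
    have "((\<lambda>s. g (Q s t) - g (Q s a)) has_vector_derivative
        integral {a..t} (\<lambda>\<tau>. partial i (partial j g) (Q (y i) \<tau>))) (at (y i))"
      by (rule has_vector_derivative_transform_within_open[OF leibniz[OF t] U(1,2)])
         (use ftc[OF _ t] in \<open>simp add: integral_unique\<close>)
    moreover have "((\<lambda>s. g (Q s t) - g (Q s a)) has_vector_derivative
        (partial i g (Q (y i) t) - partial i g (Q (y i) a))) (at (y i))"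
      using has_partial[OF g ij(1), of "Q (y i) t" "y i"] has_partial[OF g ij(1), of "Q (y i) a" "y i"]
        Q[OF U(2) t] Q[OF U(2), of a] ab by (auto simp: Q_upd intro!: has_vector_derivative_diff)
    ultimately show ?thesis using vector_derivative_unique_at by blast
  qed
  have "continuous_on {a..b} (\<lambda>\<tau>. partial i (partial j g) (Q (y i) \<tau>))"
    by (rule continuous_on_compose2[OF gij contQ2]) (use Q U in auto)
  then have "((\<lambda>t. integral {a..t} (\<lambda>\<tau>. partial i (partial j g) (Q (y i) \<tau>))) has_vector_derivative
      partial i (partial j g) (Q (y i) (y j))) (at (y j) within {a..b})"
    using ab by (intro integral_has_vector_derivative) auto
  then have "((\<lambda>t. integral {a..t} (\<lambda>\<tau>. partial i (partial j g) (Q (y i) \<tau>))) has_vector_derivative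
      partial i (partial j g) y) (at (y j))"
    using ab by (simp add: at_within_Icc_at Qy)
  then have "((\<lambda>t. partial i g (Q (y i) t) - partial i g (Q (y i) a)) has_vector_derivative
      partial i (partial j g) y) (at (y j))"
    by (rule has_vector_derivative_transform_within_open[where S = "{a<..<b}"]) (use ab eq in auto)
  from has_vector_derivative_add[OF this has_vector_derivative_const[of "partial i g (Q (y i) a)"]]
show ?thesis by (intro partial_eqI) (simp add: Qy)
qed simp

lemma foldr_partial_move_to_front:
  fixes g :: "(nat \<Rightarrow> real) \<Rightarrow> 'k::banach"
  assumes S: "openin (Euclidean_space n) S" and g: "smooth_on n S g"
    and "set js \<subseteq> {..<n}" "set ks \<subseteq> {..<n}" "i < n" "y \<in> S"
  shows "foldr partial (js @ i # ks) g y = foldr partial (i # js @ ks) g y"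
  using assms(3,6)
proof (induction js arbitrary: y)
  case (Cons j js)
  have sm: "smooth_on n S (foldr partial (js @ ks) g)"
    using Cons.prems assms by (intro smooth_on_foldr_partial) auto
  have "foldr partial ((j # js) @ i # ks) g y = partial j (foldr partial (js @ i # ks) g) y" by simp
  also have "\<dots> = partial j (partial i (foldr partial (js @ ks) g)) y"
    using Cons by (intro partial_cong[OF S]) auto
  also have "\<dots> = partial i (partial j (foldr partial (js @ ks) g)) y"
    using Cons.prems assms(5) sm
    by (intro partial_commute[OF S] smooth_onD smooth_on_partial) auto
  finally show ?case by simp
qed simp

lemma foldr_partial_mset_cong:
  fixes g :: "(nat \<Rightarrow> real) \<Rightarrow> 'k::banach"
  assumes S: "openin (Euclidean_space n) S" and g: "smooth_on n S g"
    and "set js \<subseteq> {..<n}" "mset js = mset ks" "y \<in> S"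
  shows "foldr partial js g y = foldr partial ks g y"
  using assms(3-5)
proof (induction js arbitrary: ks y)
  case (Cons j js)
  then have "j \<in> set ks" by (metis list.set_intros(1) mset_eq_setD)
  then obtain as bs where ks: "ks = as @ j # bs" by (meson split_list)
  have ms: "mset js = mset (as @ bs)" using Cons.prems(2) by (simp add: ks)
  have sub: "set as \<subseteq> {..<n}" "set bs \<subseteq> {..<n}"
    using mset_eq_setD[OF Cons.prems(2)] Cons.prems(1) unfolding ks by auto
  have "partial j (foldr partial js g) y = partial j (foldr partial (as @ bs) g) y"
    using Cons.prems(1,3) ms by (intro partial_cong[OF S] Cons.IH) auto
  also have "\<dots> = foldr partial ks g y"
    using foldr_partial_move_to_front[OF S g sub, of j y] Cons.prems unfolding ks by simp
  finally show ?case by simp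
qed simp

definition index_list :: "nat \<Rightarrow> (nat \<Rightarrow> nat) \<Rightarrow> nat list" where
  "index_list n I = concat (map (\<lambda>i. replicate (I i) i) [0..<n])"

lemma foldr_replicate: "foldr f (replicate m i) = f i ^^ m"
  by (induction m) auto

lemma multi_partial_eq_foldr: "multi_partial n I g = foldr partial (index_list n I) g"
proof -
  have "foldr (\<lambda>i. partial i ^^ I i) js g = foldr partial (concat (map (\<lambda>i. replicate (I i) i) js)) g" for js
    by (induction js) (auto simp: foldr_replicate)
  then show ?thesis unfolding multi_partial_def index_list_def by blast
qed

lemma set_index_list: "set (index_list n I) \<subseteq> {..<n}"
  unfolding index_list_def by (auto simp: set_replicate_conv_if split: if_splits)

lemma length_index_list: "length (index_list n I) = (\<Sum>i<n. I i)"
  unfolding index_list_def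
  by (simp add: length_concat o_def interv_sum_list_conv_sum_set_nat atLeast0LessThan)

lemma count_index_list: "count (mset (index_list n I)) i = (if i < n then I i else 0)"
  unfolding index_list_def by (induction n) (auto simp: less_Suc_eq)

text \<open>
  Because partial derivatives commute, sorting the directions of an iterated derivative of a smooth
  function turns it into one that is given by a multi-index of the same order. Thus bounds on multi-index
  derivatives, which is what the semi-norms provide, apply to derivatives in any order.
\<close>

lemma foldr_partial_eq_multi_partial:
  fixes g :: "(nat \<Rightarrow> real) \<Rightarrow> 'k::banach"
  assumes S: "openin (Euclidean_space n) S" and g: "smooth_on n S g" and ks: "set ks \<subseteq> {..<n}"
  obtains I where "I \<in> multi_indices n (length ks)" 
    "\<And>y. y \<in> S \<Longrightarrow> foldr partial ks g y = multi_partial n I g y"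
proof
  define I where "I = count (mset ks)"
  have zero: "I i = 0" if "n \<le> i" for i
    using ks that unfolding I_def by (auto simp: count_eq_zero_iff)
  have ms: "mset (index_list n I) = mset ks"
  proof (rule multiset_eqI)
    show "count (mset (index_list n I)) i = count (mset ks) i" for i
      using zero[of i] by (simp add: count_index_list I_def)
  qed
  then have "length (index_list n I) = length ks" by (metis size_mset)
  then show "I \<in> multi_indices n (length ks)"
    using zero unfolding multi_indices_def by (simp add: length_index_list)
  show "foldr partial ks g y = multi_partial n I g y" if "y \<in> S" for y
    unfolding multi_partial_eq_foldr using foldr_partial_mset_cong[OF S g ks ms[symmetric] that] .
qed

lemma finite_multi_indices: "finite (multi_indices n m)"
proof (rule finite_subset)
  show "multi_indices n m \<subseteq> {f. \<forall>i. (i \<in> {..<n} \<longrightarrow> f i \<in> {..m}) \<and> (i \<notin> {..<n} \<longrightarrow> f i = 0)}"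
  proof clarify
    fix I i assume I: "I \<in> multi_indices n m"
    have "I i \<le> m" if "i < n"
      using member_le_sum[of i "{..<n}" I] I that unfolding multi_indices_def by simp
    then show "(i \<in> {..<n} \<longrightarrow> I i \<in> {..m}) \<and> (i \<notin> {..<n} \<longrightarrow> I i = 0)"
      using I unfolding multi_indices_def by auto
  qed
  show "finite {f. \<forall>i. (i \<in> {..<n} \<longrightarrow> f i \<in> {..m}) \<and> (i \<notin> {..<n} \<longrightarrow> f i = (0::nat))}"
    by (rule finite_set_of_finite_funs) auto
qed

section \<open>Algebraic operations on smooth functions\<close>

lemma smooth_on_mult:
  fixes f g :: "(nat \<Rightarrow> real) \<Rightarrow> 'k::real_normed_field"
  assumes "openin (Euclidean_space n) S" "smooth_on n S f" "smooth_on n S g"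
  shows "smooth_on n S (\<lambda>y. f y * g y)"
  using assms(2,3) bounded_bilinear.Ck_prod[OF bounded_bilinear_mult assms(1)]
  unfolding smooth_on_iff_Ck by blast

lemma smooth_on_add:
  assumes "openin (Euclidean_space n) S" "smooth_on n S f" "smooth_on n S g"
  shows "smooth_on n S (\<lambda>y. f y + g y)"
  using assms(2,3) unfolding smooth_on_iff_Ck by (auto intro: Ck_add[OF assms(1)])

lemma smooth_on_sum:
  assumes "openin (Euclidean_space n) S" "\<And>j. j \<in> J \<Longrightarrow> smooth_on n S (f j)"
  shows "smooth_on n S (\<lambda>y. \<Sum>j\<in>J. f j y)"
  using assms(2) unfolding smooth_on_iff_Ck by (auto intro: Ck_sum[OF assms(1)])

lemma smooth_on_const: "smooth_on n S (\<lambda>_. c)"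
  unfolding smooth_on_iff_Ck by (simp add: Ck_const)

lemma foldr_partial_const_zero: "foldr partial js (\<lambda>_. 0) = (\<lambda>_. 0)"
proof (induction js)
  case (Cons j js)
  then show ?case by (simp add: partial_def fun_eq_iff)
qed simp

lemma foldr_partial_add:
  assumes S: "openin (Euclidean_space n) S" and "smooth_on n S f" "smooth_on n S g" "set js \<subseteq> {..<n}" "y \<in> S"
  shows "foldr partial js (\<lambda>y. f y + g y) y = foldr partial js f y + foldr partial js g y"
  using assms(4,5)
proof (induction js arbitrary: y)
  case (Cons j js)
  have "partial j (foldr partial js (\<lambda>y. f y + g y)) y =
      partial j (\<lambda>y. foldr partial js f y + foldr partial js g y) y"
    using Cons by (intro partial_cong[OF S]) auto
  also have "\<dots> = partial j (foldr partial js f) y + partial j (foldr partial js g) y"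
    using Cons.prems assms(2,3)
    by (intro partial_add[of n S] smooth_onD smooth_on_foldr_partial) auto
  finally show ?case by simp
qed simp

lemma foldr_partial_cmult:
  fixes f :: "(nat \<Rightarrow> real) \<Rightarrow> 'k::real_normed_field"
  assumes S: "openin (Euclidean_space n) S" and "smooth_on n S f" "set js \<subseteq> {..<n}" "y \<in> S"
  shows "foldr partial js (\<lambda>y. c * f y) y = c * foldr partial js f y"
  using assms(3,4)
proof (induction js arbitrary: y)
  case (Cons j js)
  have "partial j (foldr partial js (\<lambda>y. c * f y)) y = partial j (\<lambda>y. c * foldr partial js f y) y"
    using Cons by (intro partial_cong[OF S]) auto
  also have "\<dots> = c * partial j (foldr partial js f) y"
    using Cons.prems assms(2)
    by (intro partial_eqI has_vector_derivative_mult_right has_partial_at[of n S]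
        smooth_onD smooth_on_foldr_partial) auto
  finally show ?case by simp
qed simp

lemma foldr_partial_sum:
  assumes S: "openin (Euclidean_space n) S" and "\<And>j. j \<in> J \<Longrightarrow> smooth_on n S (f j)"
    and "set js \<subseteq> {..<n}" "y \<in> S"
  shows "foldr partial js (\<lambda>y. \<Sum>j\<in>J. f j y) y = (\<Sum>j\<in>J. foldr partial js (f j) y)"
  using assms(2)
proof (induction J rule: infinite_finite_induct)
  case (insert j J)
  then show ?case
    using foldr_partial_add[OF S, of "f j" "\<lambda>y. \<Sum>j\<in>J. f j y" js y] assms(3,4) smooth_on_sum[OF S, of J f]
    by simp
qed (simp_all add: foldr_partial_const_zero)

section \<open>Limits of smooth functions\<close>

text \<open>
  The limit function is only required to be a pointwise limit. This form is stable under
  partial derivatives, which is what makes induction on the order possible.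
\<close>

definition converges_smoothly ::
  "nat \<Rightarrow> (nat \<Rightarrow> real) set \<Rightarrow> (nat \<Rightarrow> (nat \<Rightarrow> real) \<Rightarrow> 'k::real_normed_vector) \<Rightarrow> ((nat \<Rightarrow> real) \<Rightarrow> 'k) \<Rightarrow> bool" where
  "converges_smoothly n S g h \<longleftrightarrow>
     (\<forall>m. smooth_on n S (g m)) \<and>
     (\<forall>js. set js \<subseteq> {..<n} \<longrightarrow> uniformly_Cauchy_on S (\<lambda>m. foldr partial js (g m))) \<and>
     (\<forall>y\<in>S. (\<lambda>m. g m y) \<longlonglongrightarrow> h y)"

lemma converges_smoothly_uniform_limit:
  fixes h :: "(nat \<Rightarrow> real) \<Rightarrow> 'k::banach"
  assumes "converges_smoothly n S g h"
  shows "uniform_limit S g h sequentially"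
proof -
  have "\<forall>js. set js \<subseteq> {..<n} \<longrightarrow> uniformly_Cauchy_on S (\<lambda>m. foldr partial js (g m))"
    using assms unfolding converges_smoothly_def by blast
  from this[rule_format, of "[]"] have "uniformly_Cauchy_on S g" by simp
  then obtain l where l: "uniform_limit S g l sequentially"
    using Cauchy_uniformly_convergent uniformly_convergent_on_def by blast
  have "l y = h y" if "y \<in> S" for y
    using tendsto_uniform_limitI[OF l that] assms that LIMSEQ_unique unfolding converges_smoothly_def by blast
  then show ?thesis using l uniform_limit_cong'[of S g g l h] by simp
qed

lemma converges_smoothly_continuous_on:
  fixes h :: "(nat \<Rightarrow> real) \<Rightarrow> 'k::banach"
  assumes "converges_smoothly n S g h"
  shows "continuous_on S h"
proof (rule uniform_limit_theorem[OF _ converges_smoothly_uniform_limit[OF assms]])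
  have "continuous_on S (g m)" for m
    using assms smooth_onD(1) unfolding converges_smoothly_def by blast
  then show "\<forall>\<^sub>F m in sequentially. continuous_on S (g m)" by simp
qed simp

text \<open>
  Differentiation commutes with the limit since the derivatives converge uniformly; the one-dimensional
  theorem on sequences of derivatives is applied on a small interval of the coordinate line.
\<close>

lemma converges_smoothly_partial:
  fixes h :: "(nat \<Rightarrow> real) \<Rightarrow> 'k::banach"
  assumes S: "openin (Euclidean_space n) S" and conv: "converges_smoothly n S g h" and i: "i < n"
  shows "converges_smoothly n S (\<lambda>m. partial i (g m)) (partial i h)"
    and "\<And>y. y \<in> S \<Longrightarrow> ((\<lambda>t. h (y(i := t))) has_vector_derivative partial i h y) (at (y i))"
proof -
  have cauchy: "uniformly_Cauchy_on S (\<lambda>m. foldr partial js (partial i (g m)))" if "set js \<subseteq> {..<n}" for js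
  proof -
    have "\<forall>js. set js \<subseteq> {..<n} \<longrightarrow> uniformly_Cauchy_on S (\<lambda>m. foldr partial js (g m))"
      using conv unfolding converges_smoothly_def by blast
    from this[rule_format, of "js @ [i]"] show ?thesis using i that by simp
  qed
  then have "uniformly_Cauchy_on S (\<lambda>m. partial i (g m))"
    using cauchy[of "[]"] by simp
  then obtain l where l: "uniform_limit S (\<lambda>m. partial i (g m)) l sequentially"
    using Cauchy_uniformly_convergent uniformly_convergent_on_def by blast
  have der: "((\<lambda>t. h (y(i := t))) has_vector_derivative l y) (at (y i))" if y: "y \<in> S" for y
  proof -
    obtain e where e: "e > 0" "ball (y i) e \<subseteq> {t. y(i := t) \<in> S}"
    proof -
      have "open {t. y(i := t) \<in> S}" "y i \<in> {t. y(i := t) \<in> S}"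
        using open_coordinate_line[OF S i y] y by auto
      then show ?thesis using that unfolding open_contains_ball by blast
    qed
    define B where "B = ball (y i) e"
    have B: "y(i := t) \<in> S" if "t \<in> B" for t using e(2) that unfolding B_def by blast
    have "\<exists>G. \<forall>t\<in>B. (\<lambda>m. g m (y(i := t))) \<longlonglongrightarrow> G t \<and> (G has_derivative (\<lambda>d. d *\<^sub>R l (y(i := t)))) (at t within B)"
    proof (rule has_derivative_sequence)
      show "convex B" unfolding B_def by simp
      show "y i \<in> B" using e(1) unfolding B_def by simp
      show "(\<lambda>m. g m (y(i := y i))) \<longlonglongrightarrow> h y"
        using conv y unfolding converges_smoothly_def by simp
      fix m t assume "t \<in> B"
      then show "((\<lambda>t. g m (y(i := t))) has_derivative (\<lambda>d. d *\<^sub>R partial i (g m) (y(i := t)))) (at t within B)"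
      proof -
        have "smooth_on n S (g m)" using conv unfolding converges_smoothly_def by blast
        from has_partial[OF smooth_onD(2)[OF this] i B[OF \<open>t \<in> B\<close>]] show ?thesis
          unfolding has_vector_derivative_def by (rule has_derivative_at_withinI)
      qed
    next
      fix \<epsilon> :: real assume "\<epsilon> > 0"
      from uniform_limitD[OF l this]
      show "\<forall>\<^sub>F m in sequentially. \<forall>t\<in>B. \<forall>d. norm (d *\<^sub>R partial i (g m) (y(i := t)) - d *\<^sub>R l (y(i := t))) \<le> \<epsilon> * norm d"
      proof eventually_elim
        case (elim m)
        show ?case
        proof (intro ballI allI)
          fix t d assume "t \<in> B"
          then have "norm (partial i (g m) (y(i := t)) - l (y(i := t))) \<le> \<epsilon>"
            using elim B by (force simp: dist_norm)
          then show "norm (d *\<^sub>R partial i (g m) (y(i := t)) - d *\<^sub>R l (y(i := t))) \<le> \<epsilon> * norm d"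
            by (simp flip: scaleR_diff_right add: mult.commute[of \<epsilon>] mult_left_mono)
        qed
      qed
    qed
    then obtain G where G: "\<And>t. t \<in> B \<Longrightarrow> (\<lambda>m. g m (y(i := t))) \<longlonglongrightarrow> G t"
      "\<And>t. t \<in> B \<Longrightarrow> (G has_derivative (\<lambda>d. d *\<^sub>R l (y(i := t)))) (at t within B)" by blast
    have G_eq: "G t = h (y(i := t))" if "t \<in> B" for t
      using G(1)[OF that] conv B[OF that] LIMSEQ_unique unfolding converges_smoothly_def by blast
    have B_nhd: "y i \<in> B" "open B" using e(1) unfolding B_def by auto
    have "(G has_vector_derivative l y) (at (y i))"
      using G(2)[OF B_nhd(1)] at_within_open[OF B_nhd]
      unfolding has_vector_derivative_def by simp
    then show ?thesis
      by (rule has_vector_derivative_transform_within_open[OF _ B_nhd(2,1) G_eq])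
  qed
  have eq: "partial i h y = l y" if "y \<in> S" for y using der[OF that] by (rule partial_eqI)
  show "((\<lambda>t. h (y(i := t))) has_vector_derivative partial i h y) (at (y i))" if "y \<in> S" for y
    using der eq that by simp
  show "converges_smoothly n S (\<lambda>m. partial i (g m)) (partial i h)"
    unfolding converges_smoothly_def
  proof (intro conjI allI ballI impI)
    show "smooth_on n S (partial i (g m))" for m
      using conv i unfolding converges_smoothly_def by (blast intro: smooth_on_partial)
    show "(\<lambda>m. partial i (g m) y) \<longlonglongrightarrow> partial i h y" if "y \<in> S" for y
      using tendsto_uniform_limitI[OF l that] eq[OF that] by simp
  qed (rule cauchy)
qed

lemma converges_smoothly_foldr_partial:
  fixes h :: "(nat \<Rightarrow> real) \<Rightarrow> 'k::banach"
  assumes S: "openin (Euclidean_space n) S" and conv: "converges_smoothly n S g h" and "set js \<subseteq> {..<n}"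
  shows "converges_smoothly n S (\<lambda>m. foldr partial js (g m)) (foldr partial js h)"
  using assms(3)
proof (induction js)
  case (Cons j js)
  then show ?case using converges_smoothly_partial(1)[OF S, of "\<lambda>m. foldr partial js (g m)" "foldr partial js h" j] by simp
qed (use conv in simp)

lemma converges_smoothly_smooth:
  fixes h :: "(nat \<Rightarrow> real) \<Rightarrow> 'k::banach"
  assumes S: "openin (Euclidean_space n) S" and conv: "converges_smoothly n S g h"
  shows "smooth_on n S h"
proof -
  have "Ck n S k h" if "converges_smoothly n S g h" for k g and h :: "(nat \<Rightarrow> real) \<Rightarrow> 'k"
    using that
  proof (induction k arbitrary: g h)
    case 0
    then show ?case by (simp add: converges_smoothly_continuous_on)
  next
    case (Suc k)
    have "continuous_on S h"
      using converges_smoothly_continuous_on[OF Suc.prems] .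
    moreover have "partially_differentiable n S h"
      by (rule partially_differentiableI[OF converges_smoothly_partial(2)[OF S Suc.prems]])
    moreover have "Ck n S k (partial i h)" if "i < n" for i
      using Suc.IH[OF converges_smoothly_partial(1)[OF S Suc.prems that]] .
    ultimately show ?case by simp
  qed
  then show ?thesis using conv unfolding smooth_on_iff_Ck by blast
qed

section \<open>Estimates for derivatives of products\<close>

definition jet_le :: "nat \<Rightarrow> nat \<Rightarrow> ((nat \<Rightarrow> real) \<Rightarrow> 'k::real_normed_field) \<Rightarrow> (nat \<Rightarrow> real) \<Rightarrow> real \<Rightarrow> bool" where
  "jet_le n r f y P \<longleftrightarrow> (\<forall>ls. set ls \<subseteq> {..<n} \<longrightarrow> length ls \<le> r \<longrightarrow> norm (foldr partial ls f y) \<le> P)"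

text \<open>
  An expression \<open>T\<close> in two functions is bounded, uniformly on \<open>K\<close>, by a constant times the product
  of bounds for the derivatives of the two functions at the same point, up to orders \<open>r\<close> and \<open>s\<close>. Leaving the
  bounds \<open>P\<close> and \<open>Q\<close> arbitrary lets the semi-norms be inserted for them later.
\<close>

definition jet_bounded ::
  "nat \<Rightarrow> (nat \<Rightarrow> real) set \<Rightarrow> (nat \<Rightarrow> real) set \<Rightarrow> nat \<Rightarrow> nat \<Rightarrow>
    (((nat \<Rightarrow> real) \<Rightarrow> 'k::real_normed_field) \<Rightarrow> ((nat \<Rightarrow> real) \<Rightarrow> 'k) \<Rightarrow> (nat \<Rightarrow> real) \<Rightarrow> 'k) \<Rightarrow> bool" where
  "jet_bounded n S K r s T \<longleftrightarrow>
     (\<exists>M\<ge>0. \<forall>f g y P Q. smooth_on n S f \<longrightarrow> smooth_on n S g \<longrightarrow> y \<in> K \<longrightarrow>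
        jet_le n r f y P \<longrightarrow> jet_le n s g y Q \<longrightarrow> norm (T f g y) \<le> M * (P * Q))"

lemma jet_bounded_add:
  assumes "jet_bounded n S K r s T1" "jet_bounded n S K r s T2"
  shows "jet_bounded n S K r s (\<lambda>f g y. T1 f g y + T2 f g y)"
proof -
  obtain M1 where M1: "M1 \<ge> 0" "\<And>f g y P Q. \<lbrakk>smooth_on n S f; smooth_on n S g; y \<in> K;
      jet_le n r f y P; jet_le n s g y Q\<rbrakk> \<Longrightarrow> norm (T1 f g y) \<le> M1 * (P * Q)"
    using assms(1) unfolding jet_bounded_def by blast
  obtain M2 where M2: "M2 \<ge> 0" "\<And>f g y P Q. \<lbrakk>smooth_on n S f; smooth_on n S g; y \<in> K;
      jet_le n r f y P; jet_le n s g y Q\<rbrakk> \<Longrightarrow> norm (T2 f g y) \<le> M2 * (P * Q)"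
    using assms(2) unfolding jet_bounded_def by blast
  show ?thesis
    unfolding jet_bounded_def
  proof (intro exI[of _ "M1 + M2"] conjI allI impI)
    show "norm (T1 f g y + T2 f g y) \<le> (M1 + M2) * (P * Q)"
      if "smooth_on n S f" "smooth_on n S g" "y \<in> K" "jet_le n r f y P" "jet_le n s g y Q" for f g y P Q
      unfolding distrib_right by (intro norm_triangle_mono M1(2) M2(2) that)
  qed (use M1 M2 in simp)
qed

lemma jet_bounded_sum:
  assumes "\<And>j. j \<in> J \<Longrightarrow> jet_bounded n S K r s (T j)"
  shows "jet_bounded n S K r s (\<lambda>f g y. \<Sum>j\<in>J. T j f g y)"
  using assms
proof (induction J rule: infinite_finite_induct)
  case (insert j J)
  then have "jet_bounded n S K r s (\<lambda>f g y. T j f g y + (\<Sum>j\<in>J. T j f g y))"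
    by (intro jet_bounded_add) auto
  then show ?case using insert by simp
qed (auto simp: jet_bounded_def intro: exI[of _ 0])

lemma jet_bounded_mono:
  assumes "jet_bounded n S K r s T" "r \<le> r'" "s \<le> s'"
  shows "jet_bounded n S K r' s' T"
proof -
  have r: "jet_le n r f y P" if "jet_le n r' f y P" for f :: "(nat \<Rightarrow> real) \<Rightarrow> 'a" and y P
    using that assms(2) unfolding jet_le_def by auto
  have s: "jet_le n s f y P" if "jet_le n s' f y P" for f :: "(nat \<Rightarrow> real) \<Rightarrow> 'a" and y P
    using that assms(3) unfolding jet_le_def by auto
  obtain M where M: "M \<ge> 0" "\<And>f g y P Q. \<lbrakk>smooth_on n S f; smooth_on n S g; y \<in> K;
      jet_le n r f y P; jet_le n s g y Q\<rbrakk> \<Longrightarrow> norm (T f g y) \<le> M * (P * Q)"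
    using assms(1) unfolding jet_bounded_def by blast
  show ?thesis
    unfolding jet_bounded_def
  proof (intro exI[of _ M] conjI allI impI)
    show "norm (T f g y) \<le> M * (P * Q)"
      if "smooth_on n S f" "smooth_on n S g" "y \<in> K" "jet_le n r' f y P" "jet_le n s' g y Q" for f g y P Q
      using that by (intro M(2) r s)
  qed (rule M(1))
qed

lemma jet_bounded_transform:
  assumes "jet_bounded n S K r s T"
    and "\<And>f g y. \<lbrakk>smooth_on n S f; smooth_on n S g; y \<in> K\<rbrakk> \<Longrightarrow> T' f g y = T f g y"
  shows "jet_bounded n S K r s T'"
proof -
  obtain M where M: "M \<ge> 0" "\<And>f g y P Q. \<lbrakk>smooth_on n S f; smooth_on n S g; y \<in> K;
      jet_le n r f y P; jet_le n s g y Q\<rbrakk> \<Longrightarrow> norm (T f g y) \<le> M * (P * Q)"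
    using assms(1) unfolding jet_bounded_def by blast
  show ?thesis
    unfolding jet_bounded_def
  proof (intro exI[of _ M] conjI allI impI)
    show "norm (T' f g y) \<le> M * (P * Q)"
      if "smooth_on n S f" "smooth_on n S g" "y \<in> K" "jet_le n r f y P" "jet_le n s g y Q" for f g y P Q
      unfolding assms(2)[OF that(1-3)] by (rule M(2)[OF that])
  qed (rule M(1))
qed

text \<open>
  Induction on the number of outer derivatives. By the Leibniz rule the innermost of them falls on the coefficient
  \<open>a\<close>, on the first function or on the second, and each of the three terms has the same form with one outer
  derivative less. Without outer derivatives the coefficient is bounded on the compact set \<open>K\<close>.
\<close>

lemma jet_bounded_derivative_of_product:
  fixes a :: "(nat \<Rightarrow> real) \<Rightarrow> 'k::real_normed_field"
  assumes S: "openin (Euclidean_space n) S" and K: "compact K" "K \<subseteq> S"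
    and "smooth_on n S a" "set js \<subseteq> {..<n}" "set is \<subseteq> {..<n}" "set ks \<subseteq> {..<n}"
  shows "jet_bounded n S K (length js + length is) (length js + length ks)
           (\<lambda>f g. foldr partial js (\<lambda>y. a y * (foldr partial is f y * foldr partial ks g y)))"
  using assms(4-7)
proof (induction js arbitrary: a "is" ks rule: rev_induct)
  case Nil
  have "compact (a ` K)"
    using continuous_on_subset[OF smooth_onD(1)[OF Nil(1)] K(2)] K(1)
    by (rule compact_continuous_image)
  then obtain M where M: "\<And>y. y \<in> K \<Longrightarrow> norm (a y) \<le> M"
    using compact_imp_bounded bounded_iff by (metis imageI)
  show ?case
    unfolding jet_bounded_def
  proof (intro exI[of _ "\<bar>M\<bar>"] conjI allI impI)
    fix f g :: "(nat \<Rightarrow> real) \<Rightarrow> 'k" and y P Q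
    assume y: "y \<in> K"
      and PQ: "jet_le n (length [] + length is) f y P" "jet_le n (length [] + length ks) g y Q"
    have "norm (a y) \<le> \<bar>M\<bar>" using M[OF y] by linarith
    moreover have "norm (foldr partial is f y) \<le> P" "norm (foldr partial ks g y) \<le> Q"
      using PQ Nil unfolding jet_le_def by auto
    ultimately show "norm (foldr partial [] (\<lambda>y. a y * (foldr partial is f y * foldr partial ks g y)) y) \<le> \<bar>M\<bar> * (P * Q)"
      by (auto simp: norm_mult intro!: mult_mono intro: order_trans[OF norm_ge_zero])
  qed simp
next
  case (snoc j js)
  have j: "j < n" "set js \<subseteq> {..<n}" using snoc.prems by auto
  let ?T = "\<lambda>a is ks f g y. a y * (foldr partial is f y * foldr partial ks g y)"
  let ?r = "length (js @ [j]) + length is" and ?s = "length (js @ [j]) + length ks"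
  have jis: "set (j # is) \<subseteq> {..<n}" "set (j # ks) \<subseteq> {..<n}" using snoc.prems j by auto
  have bounds:
    "jet_bounded n S K ?r ?s (\<lambda>f g. foldr partial js (?T (partial j a) is ks f g))"
    "jet_bounded n S K ?r ?s (\<lambda>f g. foldr partial js (?T a (j # is) ks f g))"
    "jet_bounded n S K ?r ?s (\<lambda>f g. foldr partial js (?T a is (j # ks) f g))"
    using snoc.IH[OF smooth_on_partial[OF snoc.prems(1) j(1)] j(2) snoc.prems(3,4)]
      snoc.IH[OF snoc.prems(1) j(2) jis(1) snoc.prems(4)]
      snoc.IH[OF snoc.prems(1) j(2) snoc.prems(3) jis(2)]
    by (auto elim!: jet_bounded_mono)
  have "foldr partial (js @ [j]) (?T a is ks f g) y =
        foldr partial js (?T (partial j a) is ks f g) y +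
        (foldr partial js (?T a (j # is) ks f g) y + foldr partial js (?T a is (j # ks) f g) y)"
    if fg: "smooth_on n S f" "smooth_on n S g" and y: "y \<in> K" for f g :: "(nat \<Rightarrow> real) \<Rightarrow> 'k" and y
  proof -
    have yS: "y \<in> S" using y K(2) by blast
    have sm: "smooth_on n S (foldr partial ls f)" "smooth_on n S (foldr partial ls g)" if "set ls \<subseteq> {..<n}" for ls
      using smooth_on_foldr_partial that fg by auto
    have smT: "smooth_on n S (?T b ls ls' f g)"
      if "smooth_on n S b" "set ls \<subseteq> {..<n}" "set ls' \<subseteq> {..<n}" for b ls ls'
      by (intro smooth_on_mult[OF S] sm that)
    have leibniz: "partial j (?T a is ks f g) z =
        ?T (partial j a) is ks f g z + (?T a (j # is) ks f g z + ?T a is (j # ks) f g z)" if z: "z \<in> S" for z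
    proof -
      note hp = has_partial_at[OF smooth_onD(2) j(1) z]
      have "((\<lambda>t. ?T a is ks f g (z(j := t))) has_vector_derivative
          a z * (foldr partial is f z * partial j (foldr partial ks g) z +
                 partial j (foldr partial is f) z * foldr partial ks g z) +
          partial j a z * (foldr partial is f z * foldr partial ks g z)) (at (z j))"
        using has_vector_derivative_mult[OF hp[OF snoc.prems(1)]
           has_vector_derivative_mult[OF hp[OF sm(1)[OF snoc.prems(3)]] hp[OF sm(2)[OF snoc.prems(4)]]]]
        by (simp only: fun_upd_triv)
      from partial_eqI[OF this] show ?thesis by (simp add: algebra_simps)
    qed
    have "foldr partial (js @ [j]) (?T a is ks f g) y = foldr partial js (partial j (?T a is ks f g)) y" by simp
    also have "\<dots> = foldr partial js (\<lambda>z. ?T (partial j a) is ks f g z + (?T a (j # is) ks f g z + ?T a is (j # ks) f g z)) y"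
      using leibniz by (intro foldr_partial_cong[OF S j(2) yS])
    also have "\<dots> = foldr partial js (?T (partial j a) is ks f g) y +
        (foldr partial js (?T a (j # is) ks f g) y + foldr partial js (?T a is (j # ks) f g) y)"
    proof -
      have s: "smooth_on n S (?T (partial j a) is ks f g)" "smooth_on n S (?T a (j # is) ks f g)"
         "smooth_on n S (?T a is (j # ks) f g)"
        using snoc.prems j jis by (intro smT smooth_on_partial; simp)+
      show ?thesis
        using foldr_partial_add[OF S s(1) smooth_on_add[OF S s(2,3)] j(2) yS]
          foldr_partial_add[OF S s(2,3) j(2) yS] by simp
    qed
    finally show ?thesis .
  qed
  then show ?case
    by (intro jet_bounded_transform[OF jet_bounded_add[OF bounds(1) jet_bounded_add[OF bounds(2,3)]]])
qed

section \<open>Smooth functions on a manifold with a coordinate covering\<close>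

abbreviation chart_image :: "'x chart \<Rightarrow> (nat \<Rightarrow> real) set" where
  "chart_image c \<equiv> snd c ` fst c"

abbreviation from_coords :: "'x chart \<Rightarrow> (nat \<Rightarrow> real) \<Rightarrow> 'x" where
  "from_coords c \<equiv> inv_into (fst c) (snd c)"

lemma is_chartD:
  assumes "is_chart n c"
  shows "openin (Euclidean_space n) (chart_image c)" "continuous_on (fst c) (snd c)"
    "continuous_on (chart_image c) (from_coords c)"
    "\<And>p. p \<in> fst c \<Longrightarrow> from_coords c (snd c p) = p"
  using assms unfolding is_chart_def homeomorphism_def by auto

lemma openin_chart_image_of_open:
  assumes c: "is_chart n c" and W: "open W" "W \<subseteq> fst c"
  shows "openin (Euclidean_space n) (snd c ` W)"
proof -
  have "snd c ` W = chart_image c \<inter> from_coords c -` W"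
    using is_chartD(4)[OF c] W(2) by (auto intro!: image_eqI)
  then show ?thesis
    using openin_Euclidean_space_preimage[OF is_chartD(1)[OF c] is_chartD(3)[OF c] W(1)] by simp
qed

lemma in_coords_add: "in_coords c (\<lambda>p. f p + g p) = (\<lambda>y. in_coords c f y + in_coords c g y)"
  unfolding in_coords_def by (simp add: fun_eq_iff)

lemma in_coords_cmult: "in_coords c (\<lambda>p. a * f p) = (\<lambda>y. a * in_coords c f y)"
  unfolding in_coords_def by (simp add: fun_eq_iff)

lemma in_coords_chart: "is_chart n c \<Longrightarrow> p \<in> fst c \<Longrightarrow> in_coords c f (snd c p) = f p"
  using is_chartD(4) unfolding in_coords_def by fastforce

lemma coord_multi_partial_eq_foldr:
  "coord_multi_partial n c I f p = foldr partial (index_list n I) (in_coords c f) (snd c p)"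
  unfolding coord_multi_partial_def multi_partial_eq_foldr ..

locale covered_manifold =
  fixes n :: nat and A :: "'x::{t2_space,second_countable_topology} chart set"
    and U :: "nat \<Rightarrow> 'x set" and x :: "nat \<Rightarrow> 'x chart"
  assumes manifold: "smooth_manifold n A" and covering: "coordinate_covering A U x"
begin

lemma chart: "c \<in> A \<Longrightarrow> is_chart n c"
  using manifold unfolding smooth_manifold_def by blast

lemma covering_chart: "x i \<in> A" "is_chart n (x i)"
  and covering_open: "open (U i)"
  and covering_subset: "closure (U i) \<subseteq> fst (x i)" "U i \<subseteq> fst (x i)"
  and covering_compact: "compact (closure (U i))"
proof -
  show *: "x i \<in> A" "open (U i)" "closure (U i) \<subseteq> fst (x i)"
    using covering unfolding coordinate_covering_def by auto
  show "is_chart n (x i)" using *(1) chart by blast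
  show "U i \<subseteq> fst (x i)" using *(3) closure_subset by blast
  have "\<forall>J. finite J \<longrightarrow> compact (closure (\<Union>i\<in>J. U i))"
    using covering unfolding coordinate_covering_def by blast
  from this[rule_format, of "{i}"] show "compact (closure (U i))" by simp
qed

lemma covered: obtains i where "p \<in> U i"
  using covering unfolding coordinate_covering_def by blast

lemma smooth_functions_in_coords:
  "f \<in> smooth_functions n A \<Longrightarrow> c \<in> A \<Longrightarrow> smooth_on n (chart_image c) (in_coords c f)"
  unfolding smooth_functions_def smooth_in_chart_def by blast

lemma smooth_functionsI:
  assumes "\<And>c. c \<in> A \<Longrightarrow> smooth_on n (chart_image c) (in_coords c f)"
  shows "f \<in> smooth_functions n A"
  using assms unfolding smooth_functions_def smooth_in_chart_def by blast

lemma smooth_functions_add: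
  assumes "f \<in> smooth_functions n A" "g \<in> smooth_functions n A"
  shows "(\<lambda>p. f p + g p) \<in> smooth_functions n A"
  by (rule smooth_functionsI, unfold in_coords_add)
     (intro smooth_on_add is_chartD(1)[OF chart] smooth_functions_in_coords assms)

lemma smooth_functions_cmult:
  fixes f :: "'x \<Rightarrow> 'k::real_normed_field"
  assumes "f \<in> smooth_functions n A"
  shows "(\<lambda>p. a * f p) \<in> smooth_functions n A"
  by (rule smooth_functionsI, unfold in_coords_cmult)
     (intro smooth_on_mult smooth_on_const is_chartD(1)[OF chart] smooth_functions_in_coords assms)

lemma smooth_functions_zero: "(\<lambda>p. 0) \<in> smooth_functions n A"
  unfolding smooth_functions_def smooth_in_chart_def in_coords_def by (simp add: o_def smooth_on_const)

lemma smooth_functions_diff: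
  fixes f g :: "'x \<Rightarrow> 'k::real_normed_field"
  shows "f \<in> smooth_functions n A \<Longrightarrow> g \<in> smooth_functions n A \<Longrightarrow> (\<lambda>p. f p - g p) \<in> smooth_functions n A"
  using smooth_functions_add[of f "\<lambda>p. - 1 * g p"] smooth_functions_cmult[of g "- 1"] by simp

lemma partials_add:
  assumes "f \<in> smooth_functions n A" "g \<in> smooth_functions n A" "c \<in> A" "set js \<subseteq> {..<n}" "p \<in> fst c"
  shows "foldr partial js (in_coords c (\<lambda>p. f p + g p)) (snd c p) =
         foldr partial js (in_coords c f) (snd c p) + foldr partial js (in_coords c g) (snd c p)"
  unfolding in_coords_add
  by (rule foldr_partial_add[OF is_chartD(1)[OF chart[OF assms(3)]]
        smooth_functions_in_coords[OF assms(1,3)] smooth_functions_in_coords[OF assms(2,3)] assms(4)])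
     (use assms(5) in blast)

lemma partials_cmult:
  fixes f :: "'x \<Rightarrow> 'k::real_normed_field"
  assumes "f \<in> smooth_functions n A" "c \<in> A" "set js \<subseteq> {..<n}" "p \<in> fst c"
  shows "foldr partial js (in_coords c (\<lambda>p. a * f p)) (snd c p) = a * foldr partial js (in_coords c f) (snd c p)"
  unfolding in_coords_cmult
  by (rule foldr_partial_cmult[OF is_chartD(1)[OF chart[OF assms(2)]] smooth_functions_in_coords[OF assms(1,2)] assms(3)])
     (use assms(4) in blast)

lemma partials_diff:
  fixes f g :: "'x \<Rightarrow> 'k::real_normed_field"
  assumes "f \<in> smooth_functions n A" "g \<in> smooth_functions n A" "c \<in> A" "set js \<subseteq> {..<n}" "p \<in> fst c"
  shows "foldr partial js (in_coords c (\<lambda>p. f p - g p)) (snd c p) =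
         foldr partial js (in_coords c f) (snd c p) - foldr partial js (in_coords c g) (snd c p)"
  using partials_add[OF assms(1) smooth_functions_cmult[OF assms(2), of "-1"] assms(3-5)]
    partials_cmult[OF assms(2-5), of "-1"] by simp

lemma continuous_on_partials:
  assumes "f \<in> smooth_functions n A" "c \<in> A" "set js \<subseteq> {..<n}"
  shows "continuous_on (fst c) (\<lambda>p. foldr partial js (in_coords c f) (snd c p))"
  using continuous_on_compose2[OF smooth_onD(1)[OF smooth_on_foldr_partial[OF smooth_functions_in_coords[OF assms(1,2)] assms(3)]]
      is_chartD(2)[OF chart[OF assms(2)]]] by blast

section \<open>The semi-norms of smooth functions\<close>

abbreviation "seminorm \<equiv> smooth_seminorm n U x"

text \<open>
  This is where the closures of the members of the covering have to be compact and contained in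
  the domains of their charts: without boundedness the supremum in the semi-norm would be meaningless.
\<close>

lemma bdd_above_derivatives:
  assumes "f \<in> smooth_functions n A"
  shows "bdd_above {norm (coord_multi_partial n (x i) I f p) | i I p.
                      i \<le> l \<and> p \<in> closure (U i) \<and> I \<in> multi_indices n l}" (is "bdd_above ?D")
proof -
  have "compact ((\<lambda>p. norm (coord_multi_partial n (x i) I f p)) ` closure (U i))" for i I
    unfolding coord_multi_partial_eq_foldr
    by (rule compact_continuous_image[OF continuous_on_norm[OF continuous_on_subset[OF
        continuous_on_partials[OF assms covering_chart(1) set_index_list] covering_subset(1)]] covering_compact])
  then have "compact (\<Union>i\<in>{..l}. \<Union>I\<in>multi_indices n l. (\<lambda>p. norm (coord_multi_partial n (x i) I f p)) ` closure (U i))"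
    by (intro compact_UN finite_multi_indices finite_atMost)
  from bounded_imp_bdd_above[OF compact_imp_bounded[OF this]] show ?thesis
  proof (rule bdd_above_mono)
    show "?D \<subseteq> (\<Union>i\<in>{..l}. \<Union>I\<in>multi_indices n l. (\<lambda>p. norm (coord_multi_partial n (x i) I f p)) ` closure (U i))"
    proof clarify
      fix i I p assume "i \<le> l" "p \<in> closure (U i)" "I \<in> multi_indices n l"
      then show "norm (coord_multi_partial n (x i) I f p) \<in>
          (\<Union>i\<in>{..l}. \<Union>I\<in>multi_indices n l. (\<lambda>p. norm (coord_multi_partial n (x i) I f p)) ` closure (U i))"
        by (intro UN_I imageI) auto
    qed
  qed
qed

lemma norm_derivative_le_seminorm:
  assumes "f \<in> smooth_functions n A" "i \<le> l" "p \<in> closure (U i)" "I \<in> multi_indices n l"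
  shows "norm (coord_multi_partial n (x i) I f p) \<le> seminorm l f"
  unfolding smooth_seminorm_def
  by (rule cSup_upper) (use assms bdd_above_derivatives[OF assms(1)] in \<open>auto simp: bdd_above_insert\<close>)

lemma seminorm_nonneg:
  assumes "f \<in> smooth_functions n A"
  shows "0 \<le> seminorm l f"
  unfolding smooth_seminorm_def
  by (rule cSup_upper) (use bdd_above_derivatives[OF assms(1)] in \<open>auto simp: bdd_above_insert\<close>)

lemma seminorm_least:
  assumes "0 \<le> B"
    and "\<And>i I p. \<lbrakk>i \<le> l; p \<in> closure (U i); I \<in> multi_indices n l\<rbrakk> \<Longrightarrow> norm (coord_multi_partial n (x i) I f p) \<le> B"
  shows "seminorm l f \<le> B"
  unfolding smooth_seminorm_def by (rule cSup_least) (use assms in auto)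

lemma seminorm_mono:
  assumes f: "f \<in> smooth_functions n A" and "l \<le> l'"
  shows "seminorm l f \<le> seminorm l' f"
proof (rule seminorm_least[OF seminorm_nonneg[OF f]])
  fix i I p assume "i \<le> l" "p \<in> closure (U i)" "I \<in> multi_indices n l"
  then show "norm (coord_multi_partial n (x i) I f p) \<le> seminorm l' f"
    using assms by (intro norm_derivative_le_seminorm) (auto simp: multi_indices_def)
qed

text \<open>
  The semi-norm is a supremum over multi-indices; symmetry of mixed derivatives covers every other order of
  differentiation.
\<close>

lemma norm_partials_le_seminorm:
  fixes f :: "'x \<Rightarrow> 'k::{real_normed_field,banach}"
  assumes f: "f \<in> smooth_functions n A" and "i \<le> l" "p \<in> closure (U i)" and js: "set js \<subseteq> {..<n}" "length js \<le> l"
  shows "norm (foldr partial js (in_coords (x i) f) (snd (x i) p)) \<le> seminorm l f"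
proof -
  obtain I where I: "I \<in> multi_indices n (length js)"
    "\<And>y. y \<in> chart_image (x i) \<Longrightarrow> foldr partial js (in_coords (x i) f) y = multi_partial n I (in_coords (x i) f) y"
    using foldr_partial_eq_multi_partial[OF is_chartD(1) smooth_functions_in_coords[OF f] js(1)] covering_chart
    by metis
  have "I \<in> multi_indices n l" using I(1) js(2) by (auto simp: multi_indices_def)
  moreover have "snd (x i) p \<in> chart_image (x i)" using assms(3) covering_subset(1) by auto
  ultimately show ?thesis
    using norm_derivative_le_seminorm[OF f assms(2,3)] I(2) by (simp add: coord_multi_partial_def)
qed

lemma norm_le_seminorm:
  fixes f :: "'x \<Rightarrow> 'k::{real_normed_field,banach}"
  assumes f: "f \<in> smooth_functions n A" and "p \<in> U i"
  shows "norm (f p) \<le> seminorm i f"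
proof -
  have p: "p \<in> closure (U i)" "p \<in> fst (x i)"
    using assms(2) closure_subset covering_subset(2) by blast+
  then show ?thesis
    using norm_partials_le_seminorm[OF f order_refl p(1), of "[]"] in_coords_chart[OF covering_chart(2) p(2), of f]
    by simp
qed

lemma seminorm_triangle:
  assumes "f \<in> smooth_functions n A" "g \<in> smooth_functions n A"
  shows "seminorm l (\<lambda>p. f p + g p) \<le> seminorm l f + seminorm l g"
proof (rule seminorm_least)
  fix i I p assume i: "i \<le> l" and p: "p \<in> closure (U i)" and I: "I \<in> multi_indices n l"
  have "p \<in> fst (x i)" using p covering_subset(1) by blast
  then have "coord_multi_partial n (x i) I (\<lambda>p. f p + g p) p =
      coord_multi_partial n (x i) I f p + coord_multi_partial n (x i) I g p"
    unfolding coord_multi_partial_eq_foldr by (intro partials_add assms covering_chart set_index_list)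
  then show "norm (coord_multi_partial n (x i) I (\<lambda>p. f p + g p) p) \<le> seminorm l f + seminorm l g"
    using norm_derivative_le_seminorm[OF assms(1) i p I] norm_derivative_le_seminorm[OF assms(2) i p I]
    by (simp add: norm_triangle_mono)
qed (simp add: assms seminorm_nonneg)

lemma seminorm_cmult_le:
  fixes f :: "'x \<Rightarrow> 'k::real_normed_field"
  assumes "f \<in> smooth_functions n A"
  shows "seminorm l (\<lambda>p. a * f p) \<le> norm a * seminorm l f"
proof (rule seminorm_least)
  fix i I p assume i: "i \<le> l" and p: "p \<in> closure (U i)" and I: "I \<in> multi_indices n l"
  have "p \<in> fst (x i)" using p covering_subset(1) by blast
  then have "coord_multi_partial n (x i) I (\<lambda>p. a * f p) p = a * coord_multi_partial n (x i) I f p"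
    unfolding coord_multi_partial_eq_foldr by (intro partials_cmult assms covering_chart set_index_list)
  then show "norm (coord_multi_partial n (x i) I (\<lambda>p. a * f p) p) \<le> norm a * seminorm l f"
    using norm_derivative_le_seminorm[OF assms i p I] by (simp add: norm_mult mult_left_mono)
qed (simp add: assms seminorm_nonneg)

lemma seminorm_cmult:
  fixes f :: "'x \<Rightarrow> 'k::real_normed_field"
  assumes f: "f \<in> smooth_functions n A"
  shows "seminorm l (\<lambda>p. a * f p) = norm a * seminorm l f"
proof (cases "a = 0")
  case True
  then show ?thesis
    using seminorm_cmult_le[OF f, of l a] seminorm_nonneg[OF smooth_functions_cmult[OF f], of l a] by simp
next
  case False
  have "seminorm l f = seminorm l (\<lambda>p. inverse a * (a * f p))" using False by (simp flip: mult.assoc)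
  also have "\<dots> \<le> norm (inverse a) * seminorm l (\<lambda>p. a * f p)"
    by (rule seminorm_cmult_le[OF smooth_functions_cmult[OF f]])
  finally have "norm a * seminorm l f \<le> seminorm l (\<lambda>p. a * f p)"
    using False mult_left_mono[of "seminorm l f" _ "norm a"]
    by (fastforce simp: nonzero_norm_inverse simp flip: mult.assoc)
  then show ?thesis using seminorm_cmult_le[OF f, of l a] by simp
qed

section \<open>Completeness of the space of smooth functions\<close>

text \<open>
  Near a given point an arbitrary chart differs from one of the chosen ones by a smooth transition map, so
  smoothness in the latter carries over by the chain rule.
\<close>

lemma smooth_functions_local:
  fixes f :: "'x \<Rightarrow> 'k::real_normed_field"
  assumes loc: "\<And>i. smooth_on n (snd (x i) ` U i) (in_coords (x i) f)"
  shows "f \<in> smooth_functions n A"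
  unfolding smooth_functions_def smooth_in_chart_def smooth_on_iff_Ck
proof (intro CollectI ballI allI)
  fix c k assume c: "c \<in> A"
  note cD = is_chartD[OF chart[OF c]]
  show "Ck n (chart_image c) k (in_coords c f)"
  proof (rule Ck_local[OF cD(1)])
    fix y assume "y \<in> chart_image c"
    then obtain p where p: "p \<in> fst c" "y = snd c p" by blast
    obtain i where i: "p \<in> U i" using covered .
    define W where "W = fst c \<inter> U i"
    define \<phi> where "\<phi> = (\<lambda>y. snd (x i) (from_coords c y))"
    have W: "open W" "W \<subseteq> fst c"
      using chart[OF c] covering_open unfolding W_def is_chart_def by auto
    have T: "openin (Euclidean_space n) (snd c ` W)" by (rule openin_chart_image_of_open[OF chart[OF c] W])
    have "Ck n (snd c ` W) k (\<lambda>y. in_coords (x i) f (\<phi> y))"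
    proof (rule Ck_compose[OF openin_chart_image_of_open[OF covering_chart(2) covering_open covering_subset(2)] T])
      show "\<phi> y \<in> snd (x i) ` U i" if "y \<in> snd c ` W" for y
        using that cD(4) unfolding \<phi>_def W_def by auto
      show "Ck n (snd (x i) ` U i) k (in_coords (x i) f)"
        using loc unfolding smooth_on_iff_Ck by blast
      fix j assume "j < n"
      have "smooth_transition n c (x i)"
        using manifold c covering_chart(1) unfolding smooth_manifold_def compatible_charts_def by blast
      then have "Ck n (snd c ` (fst c \<inter> fst (x i))) k (\<lambda>y. \<phi> y j)"
        using \<open>j < n\<close> unfolding smooth_transition_def smooth_on_iff_Ck in_coords_def \<phi>_def o_def by blast
      then show "Ck n (snd c ` W) k (\<lambda>y. \<phi> y j)"
        by (rule Ck_subset) (use covering_subset(2) in \<open>auto simp: W_def\<close>)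
    qed
    then have "Ck n (snd c ` W) k (in_coords c f)"
    proof (rule Ck_transform[OF T])
      fix z assume "z \<in> snd c ` W"
      then obtain q where q: "q \<in> fst c" "q \<in> U i" "z = snd c q" unfolding W_def by blast
      then have "q \<in> fst (x i)" using covering_subset(2) by blast
      then show "in_coords c f z = in_coords (x i) f (\<phi> z)"
        using in_coords_chart[OF chart[OF c] q(1), of f] cD(4)[OF q(1)]
          in_coords_chart[OF covering_chart(2), of q i f]
        unfolding \<phi>_def q(3) by simp
    qed
    moreover have "y \<in> snd c ` W" using p i unfolding W_def by blast
    ultimately show "\<exists>T. openin (Euclidean_space n) T \<and> y \<in> T \<and> Ck n T k (in_coords c f)"
      using T by blast
  qed
qed

text \<open>
  Smoothness of the limit is obtained on the open sets \<open>U i\<close>, where limits of derivatives can be taken.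
  Only then is convergence in the semi-norms shown; these also involve the boundary
  points of \<open>U i\<close>, which are reached by continuity of the derivatives of the limit.
\<close>

lemma smooth_functions_complete:
  fixes s :: "nat \<Rightarrow> 'x \<Rightarrow> 'k::{real_normed_field,banach}"
  assumes s: "\<And>m. s m \<in> smooth_functions n A"
    and cauchy: "\<And>l \<epsilon>. \<epsilon> > 0 \<Longrightarrow> \<exists>N. \<forall>a\<ge>N. \<forall>b\<ge>N. seminorm l (\<lambda>p. s a p - s b p) < \<epsilon>"
  obtains f where "f \<in> smooth_functions n A" "\<And>l. (\<lambda>m. seminorm l (\<lambda>p. s m p - f p)) \<longlonglongrightarrow> 0"
proof
  define f where "f = (\<lambda>p. lim (\<lambda>m. s m p))"
  have lim: "(\<lambda>m. s m p) \<longlonglongrightarrow> f p" for p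
  proof -
    obtain i where i: "p \<in> U i" using covered .
    have "Cauchy (\<lambda>m. s m p)"
    proof (rule metric_CauchyI)
      fix e :: real assume "e > 0"
      then obtain N where N: "\<forall>a\<ge>N. \<forall>b\<ge>N. seminorm i (\<lambda>p. s a p - s b p) < e" using cauchy by blast
      have "dist (s a p) (s b p) < e" if "a \<ge> N" "b \<ge> N" for a b
        using norm_le_seminorm[OF smooth_functions_diff[OF s s] i, of a b] N that
        by (metis dist_norm order_le_less_trans)
      then show "\<exists>N. \<forall>a\<ge>N. \<forall>b\<ge>N. dist (s a p) (s b p) < e" by blast
    qed
    then show ?thesis unfolding f_def by (simp add: Cauchy_convergent_iff convergent_LIMSEQ_iff)
  qed
  have open_im: "openin (Euclidean_space n) (snd (x i) ` U i)" for i
    by (rule openin_chart_image_of_open[OF covering_chart(2) covering_open covering_subset(2)])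
  have conv: "converges_smoothly n (snd (x i) ` U i) (\<lambda>m. in_coords (x i) (s m)) (in_coords (x i) f)" for i
    unfolding converges_smoothly_def
  proof (intro conjI allI impI ballI)
    have "smooth_on n (chart_image (x i)) (in_coords (x i) (s m))" for m
      using smooth_functions_in_coords[OF s covering_chart(1)] .
    moreover have "snd (x i) ` U i \<subseteq> chart_image (x i)" using covering_subset(2) by blast
    ultimately show "smooth_on n (snd (x i) ` U i) (in_coords (x i) (s m))" for m
      unfolding smooth_on_iff_Ck by (blast intro: Ck_subset)
    show "(\<lambda>m. in_coords (x i) (s m) y) \<longlonglongrightarrow> in_coords (x i) f y" for y
      using lim unfolding in_coords_def by simp
    fix js assume js: "set js \<subseteq> {..<n}"
    show "uniformly_Cauchy_on (snd (x i) ` U i) (\<lambda>m. foldr partial js (in_coords (x i) (s m)))"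
    proof (rule uniformly_Cauchy_onI)
      fix e :: real assume "e > 0"
      \<comment> \<open>The semi-norm must see both the \<open>i\<close>-th chart and derivatives of order \<open>length js\<close>.\<close>
      define l where "l = max i (length js)"
      obtain N where N: "\<forall>a\<ge>N. \<forall>b\<ge>N. seminorm l (\<lambda>p. s a p - s b p) < e"
        using cauchy[OF \<open>e > 0\<close>] by blast
      have "dist (foldr partial js (in_coords (x i) (s a)) y) (foldr partial js (in_coords (x i) (s b)) y) < e"
        if y: "y \<in> snd (x i) ` U i" and ab: "a \<ge> N" "b \<ge> N" for y a b
      proof -
        obtain p where p: "p \<in> U i" "y = snd (x i) p" using y by blast
        have p': "p \<in> closure (U i)" "p \<in> fst (x i)" using p(1) closure_subset covering_subset(2) by blast+
        have "norm (foldr partial js (in_coords (x i) (\<lambda>p. s a p - s b p)) y) \<le> seminorm l (\<lambda>p. s a p - s b p)"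
          unfolding p(2) l_def using smooth_functions_diff[OF s s] p' js
          by (intro norm_partials_le_seminorm) auto
        also have "\<dots> < e" using N ab by blast
        finally show ?thesis
          using partials_diff[OF s s covering_chart(1) js p'(2)] unfolding p(2) by (simp add: dist_norm)
      qed
      then show "\<exists>N. \<forall>y\<in>snd (x i) ` U i. \<forall>a\<ge>N. \<forall>b\<ge>N.
          dist (foldr partial js (in_coords (x i) (s a)) y) (foldr partial js (in_coords (x i) (s b)) y) < e"
        by blast
    qed
  qed
  show f: "f \<in> smooth_functions n A"
    by (rule smooth_functions_local[OF converges_smoothly_smooth[OF open_im conv]])
  show "(\<lambda>m. seminorm l (\<lambda>p. s m p - f p)) \<longlonglongrightarrow> 0" for l
  proof (rule LIMSEQ_I)
    fix e :: real assume "e > 0"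
    then obtain N where N: "\<forall>a\<ge>N. \<forall>b\<ge>N. seminorm l (\<lambda>p. s a p - s b p) < e / 2"
      using cauchy[of "e / 2" l] by auto
    have "seminorm l (\<lambda>p. s m p - f p) \<le> e / 2" if m: "m \<ge> N" for m
    proof (rule seminorm_least)
      fix i I p assume i: "i \<le> l" and p: "p \<in> closure (U i)" and I: "I \<in> multi_indices n l"
      let ?D = "\<lambda>f p. foldr partial (index_list n I) (in_coords (x i) f) (snd (x i) p)"
      have D_diff: "?D (\<lambda>p. s m p - g p) q = ?D (s m) q - ?D g q"
        if "g \<in> smooth_functions n A" "q \<in> fst (x i)" for g q
        by (rule partials_diff[OF s that(1) covering_chart(1) set_index_list that(2)])
      \<comment> \<open>On \<open>U i\<close> the second sequence in the Cauchy condition is sent to its limit.\<close>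
      have on_U: "norm (?D (s m) q - ?D f q) \<le> e / 2" if q: "q \<in> U i" for q
      proof (rule Lim_norm_ubound[of sequentially "\<lambda>m'. ?D (s m) q - ?D (s m') q"])
        have "uniform_limit (snd (x i) ` U i) (\<lambda>m. foldr partial (index_list n I) (in_coords (x i) (s m)))
           (foldr partial (index_list n I) (in_coords (x i) f)) sequentially"
          by (rule converges_smoothly_uniform_limit[OF converges_smoothly_foldr_partial[OF open_im conv set_index_list]])
        from tendsto_uniform_limitI[OF this, of "snd (x i) q"] q
        have "(\<lambda>m'. ?D (s m') q) \<longlonglongrightarrow> ?D f q" by blast
        then show "(\<lambda>m'. ?D (s m) q - ?D (s m') q) \<longlonglongrightarrow> ?D (s m) q - ?D f q"
          by (intro tendsto_diff tendsto_const)
        have "norm (?D (s m) q - ?D (s m') q) \<le> e / 2" if "m' \<ge> N" for m'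
        proof -
          have q': "q \<in> closure (U i)" "q \<in> fst (x i)" using q closure_subset covering_subset(2) by blast+
          have "norm (coord_multi_partial n (x i) I (\<lambda>p. s m p - s m' p) q) \<le> seminorm l (\<lambda>p. s m p - s m' p)"
            by (rule norm_derivative_le_seminorm[OF smooth_functions_diff[OF s s] i q'(1) I])
          then show ?thesis
            using N m that D_diff[OF s q'(2), of m'] unfolding coord_multi_partial_eq_foldr by force
        qed
        then show "\<forall>\<^sub>F m' in sequentially. norm (?D (s m) q - ?D (s m') q) \<le> e / 2"
          by (auto simp: eventually_sequentially)
      qed simp
      have "continuous_on (fst (x i)) (\<lambda>q. norm (?D (s m) q - ?D f q))"
        by (intro continuous_on_norm continuous_on_diff continuous_on_partials s f covering_chart(1) set_index_list)
      then have "continuous_on (closure (U i)) (\<lambda>q. norm (?D (s m) q - ?D f q))"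
        by (rule continuous_on_subset[OF _ covering_subset(1)])
      then have "(\<lambda>q. norm (?D (s m) q - ?D f q)) ` closure (U i) \<subseteq> {..e / 2}"
        by (rule image_closure_subset) (use on_U in auto)
      then have "norm (?D (s m) p - ?D f p) \<le> e / 2" using p by blast
      moreover have "p \<in> fst (x i)" using p covering_subset(1) by blast
      ultimately show "norm (coord_multi_partial n (x i) I (\<lambda>p. s m p - f p) p) \<le> e / 2"
        unfolding coord_multi_partial_eq_foldr by (simp add: D_diff[OF f])
    qed (use \<open>e > 0\<close> in simp)
    then have "norm (seminorm l (\<lambda>p. s m p - f p) - 0) < e" if "m \<ge> N" for m
      using that \<open>e > 0\<close> seminorm_nonneg[OF smooth_functions_diff[OF s f], of l m] by force
    then show "\<exists>N. \<forall>m\<ge>N. norm (seminorm l (\<lambda>p. s m p - f p) - 0) < e" by blast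
  qed
qed

section \<open>Continuity of bidifferential operators\<close>

text \<open>
  In a chosen chart the operator is a finite sum of products of a smooth coefficient and a derivative of
  order at most \<open>m\<close> of each argument. Applying up to \<open>l\<close> further derivatives leads to order \<open>l + m\<close>, and the constants
  obtained for the finitely many charts and multi-indices are added up.
\<close>

lemma bidifferential_operator_bound:
  fixes B :: "('x \<Rightarrow> 'k::{real_normed_field,banach}) \<Rightarrow> ('x \<Rightarrow> 'k) \<Rightarrow> 'x \<Rightarrow> 'k"
  assumes B: "bidifferential_operator n A m B"
  obtains M where "M \<ge> 0" "\<And>f g. \<lbrakk>f \<in> smooth_functions n A; g \<in> smooth_functions n A\<rbrakk> \<Longrightarrow>
    seminorm l (B f g) \<le> M * (seminorm (l + m) f * seminorm (l + m) g)"
proof -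
  let ?N = "\<lambda>f g :: 'x \<Rightarrow> 'k. seminorm (l + m) f * seminorm (l + m) g"
  define Q where "Q = (\<lambda>i L M. 0 \<le> M \<and> (\<forall>f g p. f \<in> smooth_functions n A \<longrightarrow> g \<in> smooth_functions n A \<longrightarrow>
      p \<in> closure (U i) \<longrightarrow> norm (coord_multi_partial n (x i) L (B f g) p) \<le> M * ?N f g))"
  have local_bound: "\<exists>M. Q i L M" if i: "i \<le> l" and L: "L \<in> multi_indices n l" for i L
  proof -
    let ?S = "chart_image (x i)" and ?K = "snd (x i) ` closure (U i)" and ?js = "index_list n L"
    note chD = is_chartD[OF covering_chart(2)[of i]]
    obtain a where a: "\<forall>I\<in>multi_indices n m. \<forall>J\<in>multi_indices n m. smooth_in_chart n (x i) (a I J)"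
      and Beq: "\<forall>f\<in>smooth_functions n A. \<forall>g\<in>smooth_functions n A. \<forall>p\<in>fst (x i).
           B f g p = (\<Sum>I\<in>multi_indices n m. \<Sum>J\<in>multi_indices n m.
                a I J p * coord_multi_partial n (x i) I f p * coord_multi_partial n (x i) J g p)"
      using B covering_chart(1)[of i] unfolding bidifferential_operator_def by blast
    define a' where "a' = (\<lambda>I J. in_coords (x i) (a I J))"
    let ?P = "\<lambda>I J \<phi> \<psi> y. a' I J y * (foldr partial (index_list n I) \<phi> y * foldr partial (index_list n J) \<psi> y)"
    have K: "compact ?K" "?K \<subseteq> ?S"
      using compact_continuous_image[OF continuous_on_subset[OF chD(2) covering_subset(1)] covering_compact]
        covering_subset(1)[of i] by auto
    have a'_smooth: "smooth_on n ?S (a' I J)" if "I \<in> multi_indices n m" "J \<in> multi_indices n m" for I J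
      using a that unfolding a'_def smooth_in_chart_def by blast
    have len: "length (index_list n I) \<le> r" if "I \<in> multi_indices n r" for I r
      using that by (simp add: length_index_list multi_indices_def)
    have "jet_bounded n ?S ?K (l + m) (l + m) (\<lambda>\<phi> \<psi>. foldr partial ?js (?P I J \<phi> \<psi>))"
      if "I \<in> multi_indices n m" "J \<in> multi_indices n m" for I J
      by (rule jet_bounded_mono[OF jet_bounded_derivative_of_product[OF chD(1) K a'_smooth[OF that]
            set_index_list set_index_list set_index_list]])
         (use len[OF L] len[OF that(1)] len[OF that(2)] in auto)
    then have "jet_bounded n ?S ?K (l + m) (l + m) (\<lambda>\<phi> \<psi> y. \<Sum>I\<in>multi_indices n m. \<Sum>J\<in>multi_indices n m.
         foldr partial ?js (?P I J \<phi> \<psi>) y)"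
      by (intro jet_bounded_sum)
    then obtain M where M: "M \<ge> 0" "\<And>\<phi> \<psi> y P Q. \<lbrakk>smooth_on n ?S \<phi>; smooth_on n ?S \<psi>; y \<in> ?K;
        jet_le n (l + m) \<phi> y P; jet_le n (l + m) \<psi> y Q\<rbrakk> \<Longrightarrow>
        norm (\<Sum>I\<in>multi_indices n m. \<Sum>J\<in>multi_indices n m. foldr partial ?js (?P I J \<phi> \<psi>) y) \<le> M * (P * Q)"
      unfolding jet_bounded_def by blast
    have "norm (coord_multi_partial n (x i) L (B f g) p) \<le> M * ?N f g"
      if f: "f \<in> smooth_functions n A" and g: "g \<in> smooth_functions n A" and p: "p \<in> closure (U i)" for f g p
    proof -
      let ?\<phi> = "in_coords (x i) f" and ?\<psi> = "in_coords (x i) g"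
      have p': "p \<in> fst (x i)" using p covering_subset(1) by blast
      have sm: "smooth_on n ?S ?\<phi>" "smooth_on n ?S ?\<psi>"
        using smooth_functions_in_coords f g covering_chart(1) by blast+
      have smP: "smooth_on n ?S (?P I J ?\<phi> ?\<psi>)" if "I \<in> multi_indices n m" "J \<in> multi_indices n m" for I J
        by (intro smooth_on_mult[OF chD(1)] a'_smooth that smooth_on_foldr_partial sm set_index_list)
      have "in_coords (x i) (B f g) y = (\<Sum>I\<in>multi_indices n m. \<Sum>J\<in>multi_indices n m. ?P I J ?\<phi> ?\<psi> y)"
        if y: "y \<in> ?S" for y
      proof -
        obtain q where q: "q \<in> fst (x i)" "y = snd (x i) q" using y by blast
        show ?thesis
          using Beq[rule_format, OF f g q(1)] in_coords_chart[OF covering_chart(2) q(1), of "B f g"]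
            in_coords_chart[OF covering_chart(2) q(1), of "a I J" for I J]
          unfolding q(2) a'_def coord_multi_partial_eq_foldr by (simp add: mult.assoc)
      qed
      then have "coord_multi_partial n (x i) L (B f g) p = foldr partial ?js
          (\<lambda>y. \<Sum>I\<in>multi_indices n m. \<Sum>J\<in>multi_indices n m. ?P I J ?\<phi> ?\<psi> y) (snd (x i) p)"
        unfolding coord_multi_partial_eq_foldr using p'
        by (intro foldr_partial_cong[OF chD(1) set_index_list]) auto
      also have "\<dots> = (\<Sum>I\<in>multi_indices n m. foldr partial ?js
          (\<lambda>y. \<Sum>J\<in>multi_indices n m. ?P I J ?\<phi> ?\<psi> y) (snd (x i) p))"
        using p' smP by (intro foldr_partial_sum[OF chD(1) _ set_index_list] smooth_on_sum[OF chD(1)]) auto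
      also have "\<dots> = (\<Sum>I\<in>multi_indices n m. \<Sum>J\<in>multi_indices n m. foldr partial ?js (?P I J ?\<phi> ?\<psi>) (snd (x i) p))"
        using p' smP by (intro sum.cong refl foldr_partial_sum[OF chD(1) _ set_index_list]) auto
      finally have eq: "coord_multi_partial n (x i) L (B f g) p =
        (\<Sum>I\<in>multi_indices n m. \<Sum>J\<in>multi_indices n m. foldr partial ?js (?P I J ?\<phi> ?\<psi>) (snd (x i) p))" .
      have "jet_le n (l + m) (in_coords (x i) h) (snd (x i) p) (seminorm (l + m) h)"
        if "h \<in> smooth_functions n A" for h :: "'x \<Rightarrow> 'k"
        unfolding jet_le_def using norm_partials_le_seminorm[OF that _ p] i by simp
      then show ?thesis
        unfolding eq using f g p by (intro M(2) sm) auto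
    qed
    then show ?thesis using M(1) unfolding Q_def by blast
  qed
  then obtain M where "\<And>i L. \<lbrakk>i \<le> l; L \<in> multi_indices n l\<rbrakk> \<Longrightarrow> Q i L (M i L)" by metis
  then have M: "\<And>i L. \<lbrakk>i \<le> l; L \<in> multi_indices n l\<rbrakk> \<Longrightarrow> M i L \<ge> 0"
    "\<And>i L f g p. \<lbrakk>i \<le> l; L \<in> multi_indices n l; f \<in> smooth_functions n A; g \<in> smooth_functions n A; p \<in> closure (U i)\<rbrakk>
      \<Longrightarrow> norm (coord_multi_partial n (x i) L (B f g) p) \<le> M i L * ?N f g"
    unfolding Q_def by blast+
  define M' where "M' = (\<Sum>i\<le>l. \<Sum>L\<in>multi_indices n l. M i L)"
  show ?thesis
  proof (rule that[of M'])
    show "M' \<ge> 0" unfolding M'_def by (intro sum_nonneg M(1)) auto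
    fix f g :: "'x \<Rightarrow> 'k" assume f: "f \<in> smooth_functions n A" and g: "g \<in> smooth_functions n A"
    have N: "?N f g \<ge> 0" by (intro mult_nonneg_nonneg seminorm_nonneg f g)
    show "seminorm l (B f g) \<le> M' * ?N f g"
    proof (rule seminorm_least)
      fix i I p assume i: "i \<le> l" and p: "p \<in> closure (U i)" and I: "I \<in> multi_indices n l"
      have "M i I \<le> (\<Sum>L\<in>multi_indices n l. M i L)"
        using i I M(1) finite_multi_indices by (intro member_le_sum) auto
      also have "\<dots> \<le> M'"
        unfolding M'_def using i M(1)
        by (intro member_le_sum[where f = "\<lambda>i. \<Sum>L\<in>multi_indices n l. M i L"]) (auto intro: sum_nonneg)
      finally have "M i I * ?N f g \<le> M' * ?N f g" by (rule mult_right_mono[OF _ N])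
      with M(2)[OF i I f g p] show "norm (coord_multi_partial n (x i) I (B f g) p) \<le> M' * ?N f g"
        by (rule order_trans)
    qed (use \<open>M' \<ge> 0\<close> N in simp)
  qed
qed

end

section \<open>Formal series and the Frechet metric\<close>

lemma formal_scale_const_nth: "fps_nth (formal_scale (fps_const a) F) i = (\<lambda>p. a * fps_nth F i p)"
proof -
  have "Abs_fps (\<lambda>i (p :: 'a). fps_nth (fps_const a) i) = fps_const (\<lambda>p. a)"
    by (rule fps_ext) (auto simp: fun_eq_iff)
  then show ?thesis unfolding formal_scale_def by (simp add: fun_eq_iff)
qed

lemma formal_scale_X: "formal_scale fps_X F = fps_X * F"
proof -
  have "Abs_fps (\<lambda>i (p :: 'a). fps_nth (fps_X :: 'b fps) i) = fps_X"
    by (rule fps_ext) (auto simp: fun_eq_iff)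
  then show ?thesis unfolding formal_scale_def by simp
qed

text \<open>
  The metric topology is that of convergence in each semi-norm. A single semi-norm is recovered
  from its summand since \<open>s \<mapsto> s / (1 + s)\<close> has the continuous inverse \<open>t \<mapsto> t / (1 - t)\<close>. Conversely, the
  geometric series dominates, so that the limit can be taken in each summand.
\<close>

lemma frechet_dist_tendsto_0_iff:
  assumes nonneg: "\<And>i k. 0 \<le> q k (r i - u)"
  shows "(\<lambda>i. frechet_dist q (r i) u) \<longlonglongrightarrow> 0 \<longleftrightarrow> (\<forall>k. (\<lambda>i. q k (r i - u)) \<longlonglongrightarrow> 0)"
proof
  define t where "t = (\<lambda>k i. q k (r i - u) / (1 + q k (r i - u)))"
  have t: "0 \<le> t k i" "t k i < 1" for k i
    using nonneg[of k i] unfolding t_def by (auto simp: divide_simps)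
  have dist: "frechet_dist q (r i) u = (\<Sum>k. (1 / 2) ^ k * t k i)" for i
    unfolding frechet_dist_def t_def ..
  have summable: "summable (\<lambda>k. (1 / 2) ^ k * t k i)" for i
  proof (rule summable_comparison_test'[where g = "\<lambda>k. (1 / 2) ^ k"])
    show "norm ((1 / 2) ^ k * t k i) \<le> (1 / 2) ^ k" if "k \<ge> 0" for k
      using t[of k i] by (simp add: abs_mult mult_left_le)
  qed (simp add: summable_geometric)
  {
    assume lim: "(\<lambda>i. frechet_dist q (r i) u) \<longlonglongrightarrow> 0"
    show "\<forall>k. (\<lambda>i. q k (r i - u)) \<longlonglongrightarrow> 0"
    proof
      fix k
      have "(\<lambda>i. t k i) \<longlonglongrightarrow> 0"
      proof (rule tendsto_sandwich[OF _ _ tendsto_const tendsto_mult_right_zero[OF lim]])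
        have "t k i \<le> 2 ^ k * frechet_dist q (r i) u" for i
        proof -
          have "(1 / 2) ^ k * t k i = (\<Sum>k\<in>{k}. (1 / 2) ^ k * t k i)" by simp
          also have "\<dots> \<le> frechet_dist q (r i) u"
            unfolding dist by (rule sum_le_suminf[OF summable]) (use t in auto)
          finally show ?thesis by (simp add: field_simps)
        qed
        then show "\<forall>\<^sub>F i in sequentially. t k i \<le> 2 ^ k * frechet_dist q (r i) u" by simp
      qed (use t in auto)
      then have "(\<lambda>i. t k i / (1 - t k i)) \<longlonglongrightarrow> 0 / (1 - 0)" by (intro tendsto_intros) auto
      moreover have "t k i / (1 - t k i) = q k (r i - u)" for i
        using nonneg[of k i] unfolding t_def by (simp add: field_simps add_nonneg_eq_0_iff)
      ultimately show "(\<lambda>i. q k (r i - u)) \<longlonglongrightarrow> 0" by simp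
    qed
  next
    assume lim: "\<forall>k. (\<lambda>i. q k (r i - u)) \<longlonglongrightarrow> 0"
    have "(\<lambda>i. (1 / 2) ^ k * t k i) \<longlonglongrightarrow> (1 / 2) ^ k * (0 / (1 + 0))" for k
      unfolding t_def using lim by (intro tendsto_intros) auto
    then have terms: "(\<lambda>i. (1 / 2) ^ k * t k i) \<longlonglongrightarrow> 0" for k by simp
    have "(\<lambda>i. \<Sum>k. (1 / 2) ^ k * t k i) \<longlonglongrightarrow> (\<Sum>k. 0)"
    proof (rule tannerys_theorem[THEN conjunct2, THEN conjunct2])
      show "\<forall>\<^sub>F (k, i) in sequentially \<times>\<^sub>F sequentially. norm ((1 / 2) ^ k * t k i) \<le> (1 / 2) ^ k"
        using t(1) less_imp_le[OF t(2)] by (intro always_eventually) (auto simp: abs_mult mult_left_le)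
    qed (use terms in \<open>auto simp: summable_geometric\<close>)
    then show "(\<lambda>i. frechet_dist q (r i) u) \<longlonglongrightarrow> 0" unfolding dist by simp
  }
qed

text \<open>
  Write \<open>F\<close> as its constant term plus \<open>\<hbar>\<close> times its shift and peel off one coefficient at a time. For
  the coefficient of \<open>\<hbar>\<^sup>k\<close> this stops after finitely many steps, since \<open>\<Phi>\<close> maps multiples of \<open>\<hbar>\<^sup>k\<^sup>+\<^sup>1\<close> to such multiples.
\<close>

lemma X_linear_nth:
  fixes \<Phi> :: "('x \<Rightarrow> 'k::real_normed_field) fps \<Rightarrow> ('x \<Rightarrow> 'k) fps"
  assumes "\<And>F G. F \<in> V \<Longrightarrow> G \<in> V \<Longrightarrow> \<Phi> (F + G) = \<Phi> F + \<Phi> G"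
    and "\<And>F. F \<in> V \<Longrightarrow> \<Phi> (fps_X * F) = fps_X * \<Phi> F"
    and "\<And>F. F \<in> V \<Longrightarrow> fps_const (fps_nth F 0) \<in> V" "\<And>F. F \<in> V \<Longrightarrow> fps_X * F \<in> V"
      "\<And>F. F \<in> V \<Longrightarrow> fps_shift 1 F \<in> V"
    and "F \<in> V"
  shows "fps_nth (\<Phi> F) k = (\<Sum>a\<le>k. fps_nth (\<Phi> (fps_const (fps_nth F a))) (k - a))"
  using assms(6)
proof (induction k arbitrary: F)
  case (0 F)
  have F: "F = fps_const (fps_nth F 0) + fps_X * fps_shift 1 F"
    by (rule fps_ext) auto
  have "\<Phi> F = \<Phi> (fps_const (fps_nth F 0)) + fps_X * \<Phi> (fps_shift 1 F)"
    by (subst F) (simp only: assms(1-5) 0)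
  then have "fps_nth (\<Phi> F) 0 = fps_nth (\<Phi> (fps_const (fps_nth F 0)) + fps_X * \<Phi> (fps_shift 1 F)) 0"
    by (rule arg_cong)
  then show ?case by simp
next
  case (Suc k F)
  have F: "F = fps_const (fps_nth F 0) + fps_X * fps_shift 1 F"
    by (rule fps_ext) auto
  have "\<Phi> F = \<Phi> (fps_const (fps_nth F 0)) + fps_X * \<Phi> (fps_shift 1 F)"
    by (subst F) (simp only: assms(1-5) Suc.prems)
  then have "fps_nth (\<Phi> F) (Suc k) =
      fps_nth (\<Phi> (fps_const (fps_nth F 0)) + fps_X * \<Phi> (fps_shift 1 F)) (Suc k)"
    by (rule arg_cong)
  also have "\<dots> = fps_nth (\<Phi> (fps_const (fps_nth F 0))) (Suc k) + fps_nth (\<Phi> (fps_shift 1 F)) k" by simp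
  also have "fps_nth (\<Phi> (fps_shift 1 F)) k = (\<Sum>a\<le>k. fps_nth (\<Phi> (fps_const (fps_nth F (Suc a)))) (k - a))"
    using Suc.IH[OF assms(5)[OF Suc.prems]] by simp
  finally show ?case by (simp only: sum.atMost_Suc_shift diff_Suc_Suc diff_zero)
qed

context covered_manifold
begin

section \<open>The Frechet space of formal functions\<close>

abbreviation "V \<equiv> formal_functions n A"

abbreviation "q \<equiv> formal_seminorm n U x"

lemma formal_functions_nth: "F \<in> V \<Longrightarrow> fps_nth F i \<in> smooth_functions n A"
  unfolding formal_functions_def by blast

lemma formal_functionsI: "(\<And>i. fps_nth F i \<in> smooth_functions n A) \<Longrightarrow> F \<in> V"
  unfolding formal_functions_def by blast

lemma smooth_functions_plus:
  "f \<in> smooth_functions n A \<Longrightarrow> g \<in> smooth_functions n A \<Longrightarrow> f + g \<in> smooth_functions n A"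
  unfolding plus_fun_def by (rule smooth_functions_add)

lemma smooth_functions_0: "0 \<in> smooth_functions n A"
  unfolding zero_fun_def by (rule smooth_functions_zero)

lemma formal_functions_add:
  fixes F G :: "('x \<Rightarrow> 'k::real_normed_field) fps"
  shows "F \<in> V \<Longrightarrow> G \<in> V \<Longrightarrow> F + G \<in> V"
  by (rule formal_functionsI) (simp add: smooth_functions_plus formal_functions_nth)

lemma formal_functions_diff:
  fixes F G :: "('x \<Rightarrow> 'k::real_normed_field) fps"
  shows "F \<in> V \<Longrightarrow> G \<in> V \<Longrightarrow> F - G \<in> V"
  by (rule formal_functionsI) (simp add: fun_diff_def smooth_functions_diff formal_functions_nth)

lemma formal_functions_const:
  fixes f :: "'x \<Rightarrow> 'k::real_normed_field"
  shows "f \<in> smooth_functions n A \<Longrightarrow> fps_const f \<in> V"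
  by (rule formal_functionsI) (simp add: smooth_functions_0)

lemma formal_functions_X:
  fixes F :: "('x \<Rightarrow> 'k::real_normed_field) fps"
  shows "F \<in> V \<Longrightarrow> fps_X * F \<in> V"
  by (rule formal_functionsI) (simp add: smooth_functions_0 formal_functions_nth)

lemma formal_functions_shift:
  fixes F :: "('x \<Rightarrow> 'k::real_normed_field) fps"
  shows "F \<in> V \<Longrightarrow> fps_shift m F \<in> V"
  by (rule formal_functionsI) (simp add: formal_functions_nth)

lemma formal_seminorm_nonneg: "F \<in> V \<Longrightarrow> 0 \<le> q k F"
  unfolding formal_seminorm_def by (intro sum_nonneg seminorm_nonneg formal_functions_nth)

lemma seminorm_nth_le:
  assumes "F \<in> V" "i \<le> k" "l \<le> k - i"
  shows "seminorm l (fps_nth F i) \<le> q k F"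
proof -
  have "seminorm l (fps_nth F i) \<le> seminorm (k - i) (fps_nth F i)"
    by (rule seminorm_mono[OF formal_functions_nth[OF assms(1)] assms(3)])
  also have "\<dots> \<le> q k F"
    unfolding formal_seminorm_def
    by (rule member_le_sum[where f = "\<lambda>i. seminorm (k - i) (fps_nth F i)"])
       (use assms seminorm_nonneg formal_functions_nth in auto)
  finally show ?thesis .
qed

lemma formal_seminorm_triangle:
  fixes F G :: "('x \<Rightarrow> 'k::real_normed_field) fps"
  assumes "F \<in> V" "G \<in> V"
  shows "q k (F + G) \<le> q k F + q k G"
  unfolding formal_seminorm_def sum.distrib[symmetric]
  using assms by (intro sum_mono) (simp add: plus_fun_def seminorm_triangle formal_functions_nth)

lemma seminorm_sum:
  fixes h :: "'j \<Rightarrow> 'x \<Rightarrow> 'k::real_normed_field"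
  assumes "\<And>j. j \<in> J \<Longrightarrow> h j \<in> smooth_functions n A"
  shows "(\<Sum>j\<in>J. h j) \<in> smooth_functions n A \<and> seminorm l (\<Sum>j\<in>J. h j) \<le> (\<Sum>j\<in>J. seminorm l (h j))"
  using assms
proof (induction J rule: infinite_finite_induct)
  case (insert j J)
  then have "seminorm l (h j + (\<Sum>j\<in>J. h j)) \<le> seminorm l (h j) + seminorm l (\<Sum>j\<in>J. h j)"
    unfolding plus_fun_def by (intro seminorm_triangle) auto
  also have "\<dots> \<le> seminorm l (h j) + (\<Sum>j\<in>J. seminorm l (h j))" using insert by simp
  finally have "seminorm l (h j + (\<Sum>j\<in>J. h j)) \<le> seminorm l (h j) + (\<Sum>j\<in>J. seminorm l (h j))" .
  moreover have "h j + (\<Sum>j\<in>J. h j) \<in> smooth_functions n A"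
    by (rule smooth_functions_plus) (use insert in auto)
  ultimately show ?case unfolding sum.insert[OF insert(1,2)] by (rule conjI[rotated])
qed (use seminorm_cmult[OF smooth_functions_zero, of l "0::'k"] in \<open>simp_all add: smooth_functions_zero zero_fun_def\<close>)

text \<open>
  The \<open>(c + l)\<close>-th semi-norm of a formal function dominates the \<open>l\<close>-th semi-norm of its \<open>c\<close>-th coefficient.
  So a Cauchy sequence has Cauchy coefficients, and the limits of these are assembled into a formal function.
\<close>

lemma frechet_space_formal_functions:
  "frechet_space (\<lambda>a. formal_scale (fps_const a)) (V :: ('x \<Rightarrow> 'k::{real_normed_field,banach}) fps set) q"
proof -
  let ?scl = "\<lambda>a. formal_scale (fps_const a) :: ('x \<Rightarrow> 'k) fps \<Rightarrow> _"
  have "formal_scale 1 F = F" for F :: "('x \<Rightarrow> 'k) fps"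
    using formal_scale_const_nth[of 1 F] by (intro fps_ext) simp
  then have vs: "vector_space ?scl"
    by unfold_locales (auto intro!: fps_ext simp: formal_scale_const_nth fun_eq_iff algebra_simps)
  then interpret vector_space ?scl .
  have scl: "?scl a F \<in> V" if "F \<in> V" for a F
    using that by (intro formal_functionsI) (simp add: formal_scale_const_nth smooth_functions_cmult formal_functions_nth)
  have "subspace V"
    by (intro subspaceI formal_functions_add scl) (auto intro!: formal_functionsI simp: smooth_functions_0)
  moreover have "seminorm_on ?scl V (q k)" for k
    unfolding seminorm_on_def
  proof (intro conjI ballI allI)
    show "q k (?scl a F) = norm a * q k F" if "F \<in> V" for a F
      using that unfolding formal_seminorm_def
      by (simp add: formal_scale_const_nth seminorm_cmult formal_functions_nth sum_distrib_left)
  qed (auto intro: formal_seminorm_nonneg formal_seminorm_triangle)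
  moreover have "F = 0" if F: "F \<in> V" and zero: "\<forall>k. q k F = 0" for F :: "('x \<Rightarrow> 'k) fps"
  proof (intro fps_ext ext)
    fix i p
    \<comment> \<open>The value at a point is visible from the semi-norm whose index is that of a covering set around the point.\<close>
    obtain j where j: "p \<in> U j" using covered .
    have "norm (fps_nth F i p) \<le> seminorm j (fps_nth F i)"
      by (rule norm_le_seminorm[OF formal_functions_nth[OF F] j])
    also have "\<dots> \<le> q (i + j) F" by (rule seminorm_nth_le[OF F]) auto
    finally show "fps_nth F i p = fps_nth 0 i p" using zero by simp
  qed
  moreover have "\<exists>v\<in>V. \<forall>k. (\<lambda>i. q k (s i - v)) \<longlonglongrightarrow> 0"
    if s: "\<And>i. s i \<in> V" and cauchy: "\<forall>k. \<forall>\<epsilon>>0. \<exists>N. \<forall>i\<ge>N. \<forall>j\<ge>N. q k (s i - s j) < \<epsilon>"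
    for s :: "nat \<Rightarrow> ('x \<Rightarrow> 'k) fps"
  proof -
    have "\<exists>f. f \<in> smooth_functions n A \<and> (\<forall>l. (\<lambda>m. seminorm l (\<lambda>p. fps_nth (s m) c p - f p)) \<longlonglongrightarrow> 0)" for c
    proof -
      have "\<exists>N. \<forall>a\<ge>N. \<forall>b\<ge>N. seminorm l (\<lambda>p. fps_nth (s a) c p - fps_nth (s b) c p) < \<epsilon>" if \<epsilon>: "\<epsilon> > 0" for l \<epsilon>
      proof -
        obtain N where N: "\<forall>i\<ge>N. \<forall>j\<ge>N. q (c + l) (s i - s j) < \<epsilon>" using cauchy \<epsilon> by blast
        have "seminorm l (\<lambda>p. fps_nth (s a) c p - fps_nth (s b) c p) \<le> q (c + l) (s a - s b)" for a b
          using seminorm_nth_le[OF formal_functions_diff[OF s s], of c "c + l" l a b] by (simp add: fun_diff_def)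
        then show ?thesis using N by (meson order_le_less_trans)
      qed
      from smooth_functions_complete[of "\<lambda>m. fps_nth (s m) c", OF formal_functions_nth[OF s] this]
      show ?thesis by blast
    qed
    then have "\<forall>c. \<exists>f. f \<in> smooth_functions n A \<and>
        (\<forall>l. (\<lambda>m. seminorm l (\<lambda>p. fps_nth (s m) c p - f p)) \<longlonglongrightarrow> 0)" ..
    from choice[OF this] obtain f where f: "\<forall>c. f c \<in> smooth_functions n A \<and>
        (\<forall>l. (\<lambda>m. seminorm l (\<lambda>p. fps_nth (s m) c p - f c p)) \<longlonglongrightarrow> 0)" ..
    have "(\<lambda>i. q k (s i - Abs_fps f)) \<longlonglongrightarrow> 0" for k
      unfolding formal_seminorm_def by (rule tendsto_null_sum) (simp add: fun_diff_def f)
    moreover have "Abs_fps f \<in> V" using f by (intro formal_functionsI) simp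
    ultimately show ?thesis by blast
  qed
  ultimately show ?thesis using vs unfolding frechet_space_def by blast
qed

text \<open>
  Seeing the pointwise product as an operator of order \<open>0\<close> lets the zeroth term of the star product be treated like
  the others.
\<close>

lemma bidifferential_operator_mult:
  "bidifferential_operator n A 0 (\<lambda>f g. f * g :: 'x \<Rightarrow> 'k::real_normed_field)"
  unfolding bidifferential_operator_def
proof (intro ballI exI[of _ "\<lambda>I J p. 1"] conjI)
  have [simp]: "multi_indices n 0 = {\<lambda>_. 0}"
    unfolding multi_indices_def by (auto simp: fun_eq_iff) (metis lessThan_iff not_le)
  fix c assume c: "c \<in> A"
  show "smooth_in_chart n c (\<lambda>p. 1 :: 'k)"
    unfolding smooth_in_chart_def in_coords_def by (simp add: o_def smooth_on_const)
  fix f g :: "'x \<Rightarrow> 'k" and p assume "p \<in> fst c"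
  have [simp]: "index_list n (\<lambda>_. 0) = []" unfolding index_list_def by (induction n) auto
  have "coord_multi_partial n c (\<lambda>_. 0) h p = h p" for h :: "'x \<Rightarrow> 'k"
    using in_coords_chart[OF chart[OF c] \<open>p \<in> fst c\<close>, of h]
    by (simp add: coord_multi_partial_eq_foldr)
  then show "(f * g) p = (\<Sum>I\<in>multi_indices n 0. \<Sum>J\<in>multi_indices n 0.
        1 * coord_multi_partial n c I f p * coord_multi_partial n c J g p)" by simp
qed

end

section \<open>Continuity of the star product\<close>

locale star_product = covered_manifold n A U x
  for n :: nat and A :: "'x::{t2_space,second_countable_topology} chart set"
    and U :: "nat \<Rightarrow> 'x set" and x :: "nat \<Rightarrow> 'x chart" +
  fixes \<omega> :: "'x two_form"
    and star :: "('x \<Rightarrow> 'k::{real_normed_field,banach}) fps \<Rightarrow> ('x \<Rightarrow> 'k) fps \<Rightarrow> ('x \<Rightarrow> 'k) fps"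
  assumes quantization: "formal_deformation_quantization n A \<omega> star"
begin

lemma star_closed: "F \<in> V \<Longrightarrow> G \<in> V \<Longrightarrow> star F G \<in> V"
  and star_assoc: "F \<in> V \<Longrightarrow> G \<in> V \<Longrightarrow> H \<in> V \<Longrightarrow> star (star F G) H = star F (star G H)"
  and star_add_left: "F \<in> V \<Longrightarrow> G \<in> V \<Longrightarrow> H \<in> V \<Longrightarrow> star (F + G) H = star F H + star G H"
  and star_add_right: "F \<in> V \<Longrightarrow> G \<in> V \<Longrightarrow> H \<in> V \<Longrightarrow> star H (F + G) = star H F + star H G"
  and star_scale_left: "F \<in> V \<Longrightarrow> G \<in> V \<Longrightarrow> star (formal_scale a F) G = formal_scale a (star F G)"
  and star_scale_right: "F \<in> V \<Longrightarrow> G \<in> V \<Longrightarrow> star F (formal_scale a G) = formal_scale a (star F G)"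
  using quantization unfolding formal_deformation_quantization_def Let_def by blast+

lemma star_X_left: "F \<in> V \<Longrightarrow> G \<in> V \<Longrightarrow> star (fps_X * F) G = fps_X * star F G"
  and star_X_right: "F \<in> V \<Longrightarrow> G \<in> V \<Longrightarrow> star F (fps_X * G) = fps_X * star F G"
  using star_scale_left[of F G fps_X] star_scale_right[of F G fps_X] by (simp_all add: formal_scale_X)

lemma star_const_bidifferential:
  "\<exists>D. (\<forall>i. bidifferential_operator n A i (D i)) \<and>
     (\<forall>f\<in>smooth_functions n A. \<forall>g\<in>smooth_functions n A. \<forall>i.
        fps_nth (star (fps_const f) (fps_const g)) i = D i f g)"
proof -
  obtain C where C: "\<forall>i\<ge>1. bidifferential_operator n A i (C i)"
    "\<forall>f\<in>smooth_functions n A. \<forall>g\<in>smooth_functions n A.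
       star (fps_const f) (fps_const g) = Abs_fps (\<lambda>i. if i = 0 then f * g else C i f g)"
    using quantization unfolding formal_deformation_quantization_def Let_def by blast
  define D where "D = (\<lambda>i. if i = 0 then (\<lambda>f g. f * g) else C i)"
  have "bidifferential_operator n A i (D i)" for i
    using C(1) bidifferential_operator_mult unfolding D_def by auto
  moreover have "fps_nth (star (fps_const f) (fps_const g)) i = D i f g"
    if "f \<in> smooth_functions n A" "g \<in> smooth_functions n A" for f g i
    using C(2) that unfolding D_def by simp
  ultimately show ?thesis by blast
qed

lemma star_nth:
  assumes F: "F \<in> V" and G: "G \<in> V"
  shows "fps_nth (star F G) k =
    (\<Sum>a\<le>k. \<Sum>b\<le>k - a. fps_nth (star (fps_const (fps_nth F a)) (fps_const (fps_nth G b))) (k - a - b))"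
proof -
  note mem = formal_functions_const[OF formal_functions_nth] formal_functions_X formal_functions_shift
  have "fps_nth (star F G) k = (\<Sum>a\<le>k. fps_nth (star (fps_const (fps_nth F a)) G) (k - a))"
    by (rule X_linear_nth[where V = V])
       (use F G in \<open>auto intro: star_add_left star_X_left mem\<close>)
  also have "\<dots> = (\<Sum>a\<le>k. \<Sum>b\<le>k - a. fps_nth (star (fps_const (fps_nth F a)) (fps_const (fps_nth G b))) (k - a - b))"
  proof (rule sum.cong[OF refl])
    fix a
    have "fps_const (fps_nth F a) \<in> V" using mem(1)[OF F] .
    then show "fps_nth (star (fps_const (fps_nth F a)) G) (k - a) =
      (\<Sum>b\<le>k - a. fps_nth (star (fps_const (fps_nth F a)) (fps_const (fps_nth G b))) (k - a - b))"
      by (intro X_linear_nth[where V = V])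
         (use G in \<open>auto intro: star_add_right star_X_right mem\<close>)
  qed
  finally show ?thesis .
qed

text \<open>
  The order of the \<open>c\<close>-th operator is compensated by the index shift in the semi-norms: the terms with
  \<open>a + b + c = m\<close> are measured with \<open>k - m\<close> derivatives and involve at most
  \<open>k - m + c = k - a - b\<close> derivatives of \<open>F\<^sub>a\<close> and of \<open>G\<^sub>b\<close>.
\<close>

lemma star_bound:
  "\<exists>M\<ge>0. \<forall>F G :: ('x \<Rightarrow> 'k) fps. F \<in> V \<longrightarrow> G \<in> V \<longrightarrow> q k (star F G) \<le> M * (q k F * q k G)"
proof -
  obtain D where D: "\<And>i. bidifferential_operator n A i (D i)"
    "\<And>f g i. f \<in> smooth_functions n A \<Longrightarrow> g \<in> smooth_functions n A \<Longrightarrow>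
       fps_nth (star (fps_const f) (fps_const g)) i = D i f g"
    using star_const_bidifferential by blast
  have "\<exists>M\<ge>0. \<forall>f g. f \<in> smooth_functions n A \<longrightarrow> g \<in> smooth_functions n A \<longrightarrow>
      seminorm l (D c f g) \<le> M * (seminorm (l + c) f * seminorm (l + c) g)" for l c
    using bidifferential_operator_bound[OF D(1)[of c], of l] by metis
  then obtain M where M: "\<And>l c. M l c \<ge> 0" "\<And>l c f g. f \<in> smooth_functions n A \<Longrightarrow> g \<in> smooth_functions n A \<Longrightarrow>
      seminorm l (D c f g) \<le> M l c * (seminorm (l + c) f * seminorm (l + c) g)" by metis
  define M' where "M' = (\<Sum>m\<le>k. \<Sum>a\<le>m. \<Sum>b\<le>m - a. M (k - m) (m - a - b))"
  show ?thesis
  proof (intro exI[of _ M'] conjI allI impI)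
    show "M' \<ge> 0" unfolding M'_def by (intro sum_nonneg M(1))
    fix F G :: "('x \<Rightarrow> 'k) fps" assume F: "F \<in> V" and G: "G \<in> V"
    have D_smooth: "D c f g \<in> smooth_functions n A"
      if "f \<in> smooth_functions n A" "g \<in> smooth_functions n A" for c f g
      using formal_functions_nth[OF star_closed[OF formal_functions_const[OF that(1)] formal_functions_const[OF that(2)]]]
        D(2)[OF that] by metis
    have nth: "fps_nth F a \<in> smooth_functions n A" "fps_nth G a \<in> smooth_functions n A" for a
      using formal_functions_nth F G by blast+
    have "seminorm (k - m) (fps_nth (star F G) m) \<le> (\<Sum>a\<le>m. \<Sum>b\<le>m - a. M (k - m) (m - a - b) * (q k F * q k G))"
      if m: "m \<le> k" for m
    proof -
      have star_m: "fps_nth (star F G) m = (\<Sum>a\<le>m. \<Sum>b\<le>m - a. D (m - a - b) (fps_nth F a) (fps_nth G b))"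
        unfolding star_nth[OF F G] by (intro sum.cong refl D(2) nth)
      have inner: "(\<Sum>b\<le>m - a. D (m - a - b) (fps_nth F a) (fps_nth G b)) \<in> smooth_functions n A" for a
        by (rule seminorm_sum[THEN conjunct1]) (rule D_smooth[OF nth])
      have "seminorm (k - m) (fps_nth (star F G) m) \<le>
          (\<Sum>a\<le>m. seminorm (k - m) (\<Sum>b\<le>m - a. D (m - a - b) (fps_nth F a) (fps_nth G b)))"
        unfolding star_m by (rule seminorm_sum[THEN conjunct2]) (rule inner)
      also have "\<dots> \<le> (\<Sum>a\<le>m. \<Sum>b\<le>m - a. seminorm (k - m) (D (m - a - b) (fps_nth F a) (fps_nth G b)))"
        by (rule sum_mono, rule seminorm_sum[THEN conjunct2], rule D_smooth[OF nth])
      also have "\<dots> \<le> (\<Sum>a\<le>m. \<Sum>b\<le>m - a. M (k - m) (m - a - b) * (q k F * q k G))"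
      proof (intro sum_mono)
        fix a b assume "a \<in> {..m}" "b \<in> {..m - a}"
        then have le: "k - m + (m - a - b) \<le> k - a" "k - m + (m - a - b) \<le> k - b" "a \<le> k" "b \<le> k"
          using m by auto
        have "seminorm (k - m) (D (m - a - b) (fps_nth F a) (fps_nth G b)) \<le>
            M (k - m) (m - a - b) * (seminorm (k - m + (m - a - b)) (fps_nth F a) * seminorm (k - m + (m - a - b)) (fps_nth G b))"
          by (rule M(2)[OF nth])
        also have "\<dots> \<le> M (k - m) (m - a - b) * (q k F * q k G)"
          by (intro mult_left_mono mult_mono seminorm_nth_le F G le M(1) formal_seminorm_nonneg seminorm_nonneg nth)
        finally show "seminorm (k - m) (D (m - a - b) (fps_nth F a) (fps_nth G b)) \<le>
            M (k - m) (m - a - b) * (q k F * q k G)" .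
      qed
      finally show ?thesis .
    qed
    then have "q k (star F G) \<le> (\<Sum>m\<le>k. \<Sum>a\<le>m. \<Sum>b\<le>m - a. M (k - m) (m - a - b) * (q k F * q k G))"
      unfolding formal_seminorm_def[of n U x k "star F G"] by (intro sum_mono) auto
    then show "q k (star F G) \<le> M' * (q k F * q k G)" unfolding M'_def by (simp add: sum_distrib_right)
  qed
qed

lemma star_jointly_continuous:
  assumes r: "\<And>i. r i \<in> V" and s: "\<And>i. s i \<in> V" and u: "u \<in> V" and v: "v \<in> V"
    and lim: "\<And>k. (\<lambda>i. q k (r i - u)) \<longlonglongrightarrow> 0" "\<And>k. (\<lambda>i. q k (s i - v)) \<longlonglongrightarrow> 0"
  shows "(\<lambda>i. q k (star (r i) (s i) - star u v)) \<longlonglongrightarrow> 0"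
proof -
  obtain M where M: "M \<ge> 0" "\<And>F G. F \<in> V \<Longrightarrow> G \<in> V \<Longrightarrow> q k (star F G) \<le> M * (q k F * q k G)"
    using star_bound[of k] by blast
  note diff = formal_functions_diff[OF r u] formal_functions_diff[OF s v]
  have bound: "q k (star (r i) (s i) - star u v) \<le>
      M * (q k (r i - u) * (q k (s i - v) + q k v)) + M * (q k u * q k (s i - v))" for i
  proof -
    have "star (r i) (s i) = star (r i - u) (s i) + star u (s i)"
      using star_add_left[OF diff(1) u s, of i i] by simp
    moreover have "star u (s i) = star u (s i - v) + star u v"
      using star_add_right[OF diff(2) v u, of i] by simp
    \<comment> \<open>The difference of products splits as for any bilinear map.\<close>
    ultimately have "star (r i) (s i) - star u v = star (r i - u) (s i) + star u (s i - v)" by simp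
    then have "q k (star (r i) (s i) - star u v) \<le> q k (star (r i - u) (s i)) + q k (star u (s i - v))"
      using formal_seminorm_triangle[OF star_closed[OF diff(1) s] star_closed[OF u diff(2)], of k i i i] by simp
    also have "\<dots> \<le> M * (q k (r i - u) * q k (s i)) + M * (q k u * q k (s i - v))"
      by (intro add_mono M(2) diff s u)
    also have "q k (s i) \<le> q k (s i - v) + q k v"
      using formal_seminorm_triangle[OF diff(2) v, of k i] by simp
    finally show ?thesis
      using M(1) formal_seminorm_nonneg[OF diff(1), of k i] by (simp add: mult_left_mono)
  qed
  have "(\<lambda>i. M * (q k (r i - u) * (q k (s i - v) + q k v)) + M * (q k u * q k (s i - v)))
      \<longlonglongrightarrow> M * (0 * (0 + q k v)) + M * (q k u * 0)"
    by (intro tendsto_intros lim)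
  then have upper: "(\<lambda>i. M * (q k (r i - u) * (q k (s i - v) + q k v)) + M * (q k u * q k (s i - v))) \<longlonglongrightarrow> 0"
    by simp
  show ?thesis
    by (rule tendsto_sandwich[OF _ _ tendsto_const upper])
       (auto intro!: always_eventually formal_seminorm_nonneg formal_functions_diff star_closed r s u v bound)
qed

lemma frechet_algebra_star: "frechet_algebra (\<lambda>a. formal_scale (fps_const a)) V q star"
  unfolding frechet_algebra_def
proof (intro conjI allI ballI impI)
  show "frechet_space (\<lambda>a. formal_scale (fps_const a)) (V :: ('x \<Rightarrow> 'k) fps set) q"
    by (rule frechet_space_formal_functions)
  fix r s :: "nat \<Rightarrow> ('x \<Rightarrow> 'k) fps" and u v
  assume "(\<forall>i. r i \<in> V) \<and> (\<forall>i. s i \<in> V) \<and> u \<in> V \<and> v \<in> V \<and>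
      (\<lambda>i. frechet_dist q (r i) u) \<longlonglongrightarrow> 0 \<and> (\<lambda>i. frechet_dist q (s i) v) \<longlonglongrightarrow> 0"
  then have mem: "\<And>i. r i \<in> V" "\<And>i. s i \<in> V" "u \<in> V" "v \<in> V"
    and lim: "(\<lambda>i. frechet_dist q (r i) u) \<longlonglongrightarrow> 0" "(\<lambda>i. frechet_dist q (s i) v) \<longlonglongrightarrow> 0" by auto
  note dist_iff = frechet_dist_tendsto_0_iff[where q = q, OF formal_seminorm_nonneg[OF formal_functions_diff]]
  have "(\<lambda>i. q k (star (r i) (s i) - star u v)) \<longlonglongrightarrow> 0" for k
    using lim dist_iff mem by (intro star_jointly_continuous) auto
  then show "(\<lambda>i. frechet_dist q (star (r i) (s i)) (star u v)) \<longlonglongrightarrow> 0"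
    using dist_iff[of "\<lambda>i. star (r i) (s i)" "star u v"] mem star_closed by simp
qed (simp_all add: star_closed star_assoc star_add_left star_add_right star_scale_left star_scale_right)

end

section \<open>The Frechet algebra of a formal deformation quantization\<close>

theorem theorem2p17:
  fixes n :: nat
    and A :: "'x::{t2_space,second_countable_topology} chart set"
    and \<omega> :: "'x two_form"
    and star :: "('x \<Rightarrow> 'k::{real_normed_field,banach}) fps \<Rightarrow> ('x \<Rightarrow> 'k) fps \<Rightarrow> ('x \<Rightarrow> 'k) fps"
    and U :: "nat \<Rightarrow> 'x set"
    and x :: "nat \<Rightarrow> 'x chart"
  assumes "symplectic_manifold n A \<omega>"
    and "formal_deformation_quantization n A \<omega> star"
    and "coordinate_covering A U x"
  shows "frechet_algebra (\<lambda>a. formal_scale (fps_const a)) (formal_functions n A)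
           (formal_seminorm n U x) star"
proof -
  interpret star_product n A U x \<omega> star
    using assms by unfold_locales (auto simp: symplectic_manifold_def)
  show ?thesis by (rule frechet_algebra_star)
qed

end
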